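(* Let $\mathbb{K}$ be a field of characteristic not $2$, let $p\ge 1$, and let $V$ be a $\mathbb{K}$-vector space equipped with a nondegenerate symmetric bilinear form of maximal Witt index $p=\lfloor\frac{\dim V}{2}\rfloor$. (i) If $\dim V=2p+1$, then $\hat{Gr}_{\mathrm{iso}}(p,V)\subset\bigwedge^pV$ is set-theoretically the common zero locus of quadrics (homogeneous quadratic polynomials on $\bigwedge^pV$) of rank at most $4$. (ii) If $\dim V=2p$, then each of the two irreducible components of $\hat{Gr}_{\mathrm{iso}}(p,V)\subset\bigwedge^pV$ is set-theoretically the common zero locus of linear forms and quadrics of rank at most $4$.
   Context: The Witt index is the common dimension of all maximal isotropic subspaces (a subspace $L$ is isotropic if $\langle u,w\rangle=0$ for all $u,w\in L$). The isotropic Grassmann cone is $$\hat{Gr}_{\mathrm{iso}}(p,V)=\{v_1\wedge\cdots\wedge v_p\mid v_i\in V,\ \langle v_i,v_j\rangle=0\text{ for all }i,j\}\subset\bigwedge\nolimits^pV.$$ The rank of a quadric is the rank of its associated symmetric bilinear form. When $\dim V=2p$, the variety $\hat{Gr}_{\mathrm{iso}}(p,V)$ has two irreducible components, corresponding to the two families of maximal isotropic subspaces: nonzero $v_1\wedge\cdots\wedge v_p$ and $w_1\wedge\cdots\wedge w_p$ in $\hat{Gr}_{\mathrm{iso}}(p,V)$ belong to the same component if and only if $\dim(\mathrm{span}\{v_i\}\cap\mathrm{span}\{w_i\})\equiv p \pmod 2$; both components contain $0$. *)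

theory Defs
  imports Complex_Main "HOL-Library.Function_Algebras" "HOL-Number_Theory.Cong"
begin

text \<open>
  A vector space over a field \<open>'k\<close> is a type \<open>'v\<close> with a scalar multiplication \<open>sV\<close> satisfying
  \<open>vector_space sV\<close>; the field itself is the vector space with scalar multiplication \<open>(*)\<close>.
  Elements of \<open>V\<^sup>p\<close> are lists of length \<open>p\<close>; the functions on \<open>V\<^sup>p\<close> below are total on lists, but
  only their values at lists of length \<open>p\<close> are ever constrained or used.
\<close>

subsection \<open>Exterior powers\<close>

definition alternating_multilinear ::
  "('k::field \<Rightarrow> 'v::ab_group_add \<Rightarrow> 'v) \<Rightarrow> ('k \<Rightarrow> 'u::ab_group_add \<Rightarrow> 'u) \<Rightarrow> nat
    \<Rightarrow> ('v list \<Rightarrow> 'u) \<Rightarrow> bool" where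
  "alternating_multilinear sV sU p f \<longleftrightarrow>
     (\<forall>vs i. length vs = p \<longrightarrow> i < p \<longrightarrow> Vector_Spaces.linear sV sU (\<lambda>x. f (vs[i := x]))) \<and>
     (\<forall>vs i j. length vs = p \<longrightarrow> i < j \<longrightarrow> j < p \<longrightarrow> vs ! i = vs ! j \<longrightarrow> f vs = 0)"

text \<open>
  The vector space \<open>(W, sW)\<close> together with the map \<open>wedge [v\<^sub>1, \<dots>, v\<^sub>p] = v\<^sub>1 \<and> \<dots> \<and> v\<^sub>p\<close> is a \<open>p\<close>-th
  exterior power of \<open>(V, sV)\<close>. A definition cannot quantify over the type of the target space, so the
  universal property is required for the target \<open>'k\<close> only; the lemma \<open>exterior_power_universal\<close>
  shows that it then holds for every target space.
\<close>

definition exterior_power ::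
  "('k::field \<Rightarrow> 'v::ab_group_add \<Rightarrow> 'v) \<Rightarrow> ('k \<Rightarrow> 'w::ab_group_add \<Rightarrow> 'w) \<Rightarrow> nat
    \<Rightarrow> ('v list \<Rightarrow> 'w) \<Rightarrow> bool" where
  "exterior_power sV sW p wedge \<longleftrightarrow>
     vector_space sV \<and> vector_space sW \<and>
     alternating_multilinear sV sW p wedge \<and>
     (\<forall>f. alternating_multilinear sV (*) p f \<longrightarrow>
        (\<exists>!g. Vector_Spaces.linear sW (*) g \<and> (\<forall>vs. length vs = p \<longrightarrow> g (wedge vs) = f vs)))"

lemma vector_space_field: "vector_space ((*) :: 'k::field \<Rightarrow> 'k \<Rightarrow> 'k)"
  by unfold_locales (simp_all add: algebra_simps)

lemma linear_forms_separate:
  assumes "vector_space sU" and "x \<noteq> 0"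
  shows "\<exists>h. Vector_Spaces.linear sU ((*) :: 'k::field \<Rightarrow> 'k \<Rightarrow> 'k) h \<and> h x \<noteq> 0"
proof -
  interpret U: vector_space sU by fact
  interpret K: vector_space "(*) :: 'k \<Rightarrow> 'k \<Rightarrow> 'k" by (rule vector_space_field)
  interpret P: vector_space_pair sU "(*) :: 'k \<Rightarrow> 'k \<Rightarrow> 'k" by unfold_locales
  have "U.independent {x}"
    using assms(2) by (simp add: U.dependent_single)
  then have "\<exists>h. Vector_Spaces.linear sU (*) h \<and> (\<forall>y\<in>{x}. h y = (\<lambda>_. 1 :: 'k) y)"
    by (rule P.linear_independent_extend)
  then show ?thesis by fastforce
qed

lemma exterior_power_span:
  assumes "exterior_power sV sW p wedge"
  shows "module.span sW (wedge ` {vs. length vs = p}) = UNIV"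
proof (rule ccontr)
  assume ne: "\<not> ?thesis"
  interpret W: vector_space sW using assms by (simp add: exterior_power_def)
  interpret V: vector_space sV using assms by (simp add: exterior_power_def)
  interpret K: vector_space "(*) :: 'a \<Rightarrow> 'a \<Rightarrow> 'a" by (rule vector_space_field)
  interpret P: vector_space_pair sW "(*) :: 'a \<Rightarrow> 'a \<Rightarrow> 'a" by unfold_locales
  interpret Q: vector_space_pair sV "(*) :: 'a \<Rightarrow> 'a \<Rightarrow> 'a" by unfold_locales
  let ?S = "wedge ` {vs. length vs = p}"
  obtain x where x: "x \<notin> W.span ?S" using ne by auto
  obtain B where B: "B \<subseteq> ?S" "W.independent B" "?S \<subseteq> W.span B"
    using W.maximal_independent_subset by metis
  have xB: "x \<notin> W.span B" using x B(1) W.span_mono by blast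
  then have ind: "W.independent (insert x B)"
    using B(2) by (simp add: W.independent_insert)
  obtain h where h: "Vector_Spaces.linear sW (*) h"
      and hB: "\<forall>y\<in>insert x B. h y = (if y = x then 1 else 0 :: 'a)"
    using P.linear_independent_extend[OF ind, of "\<lambda>y. if y = x then 1 else 0 :: 'a"] by blast
  have "x \<notin> B" using xB W.span_base by blast
  then have "\<forall>y\<in>B. h y = 0" using hB by auto
  then have h0: "h y = 0" if "y \<in> W.span B" for y
    using P.linear_eq_0_on_span[OF h _ that] by blast
  have z: "Vector_Spaces.linear sW (*) (\<lambda>_. 0 :: 'a)"
    by (rule P.linear_zero)
  have "alternating_multilinear sV (*) p (\<lambda>_. 0 :: 'a)"
    using Q.linear_zero by (simp add: alternating_multilinear_def)
  then have "\<exists>!g. Vector_Spaces.linear sW (*) g \<and> (\<forall>vs. length vs = p \<longrightarrow> g (wedge vs) = (0 :: 'a))"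
    using assms unfolding exterior_power_def by blast
  moreover have "\<forall>vs. length vs = p \<longrightarrow> h (wedge vs) = 0"
    using h0 B(3) by blast
  ultimately have "h = (\<lambda>_. 0)" using h z by blast
  then show False using hB by auto
qed

lemma exterior_power_universal:
  fixes sU :: "'k::field \<Rightarrow> 'u::ab_group_add \<Rightarrow> 'u"
  assumes E: "exterior_power sV sW p wedge" and U: "vector_space sU"
    and f: "alternating_multilinear sV sU p f"
  shows "\<exists>!g. Vector_Spaces.linear sW sU g \<and> (\<forall>vs. length vs = p \<longrightarrow> g (wedge vs) = f vs)"
proof (rule ex_ex1I)
  interpret W: vector_space sW using E by (simp add: exterior_power_def)
  interpret U: vector_space sU by fact
  interpret K: vector_space "(*) :: 'k \<Rightarrow> 'k \<Rightarrow> 'k" by (rule vector_space_field)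
  interpret P: vector_space_pair sW sU by unfold_locales
  interpret Q: vector_space_pair sW "(*) :: 'k \<Rightarrow> 'k \<Rightarrow> 'k" by unfold_locales
  let ?S = "wedge ` {vs. length vs = p}"
  have sp: "W.span ?S = UNIV" by (rule exterior_power_span[OF E])
  obtain B where B: "B \<subseteq> ?S" "W.independent B" "?S \<subseteq> W.span B"
    using W.maximal_independent_subset by metis
  have spB: "W.span B = UNIV"
    using B(3) sp W.span_mono[OF B(3)] W.span_span by auto
  have "\<forall>b\<in>B. \<exists>vs. length vs = p \<and> wedge vs = b" using B(1) by blast
  then obtain r where r: "\<And>b. b \<in> B \<Longrightarrow> length (r b) = p \<and> wedge (r b) = b" by metis
  obtain g where g: "Vector_Spaces.linear sW sU g" and gB: "\<forall>b\<in>B. g b = f (r b)"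
    using P.linear_independent_extend[OF B(2), of "\<lambda>b. f (r b)"] by blast
  have "g (wedge vs) = f vs" if vs: "length vs = p" for vs
  proof (rule ccontr)
    assume "g (wedge vs) \<noteq> f vs"
    then obtain h where h: "Vector_Spaces.linear sU ((*) :: 'k \<Rightarrow> 'k \<Rightarrow> 'k) h"
        and hx: "h (g (wedge vs) - f vs) \<noteq> 0"
      using linear_forms_separate[OF U, of "g (wedge vs) - f vs"] by auto
    interpret h: Vector_Spaces.linear sU "(*) :: 'k \<Rightarrow> 'k \<Rightarrow> 'k" h by fact
    have "alternating_multilinear sV (*) p (\<lambda>vs. h (f vs))"
      using f Vector_Spaces.linear_compose[OF _ h] h.zero
      unfolding alternating_multilinear_def o_def by metis
    then obtain k where k: "Vector_Spaces.linear sW ((*) :: 'k \<Rightarrow> 'k \<Rightarrow> 'k) k"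
        and kw: "\<And>vs. length vs = p \<Longrightarrow> k (wedge vs) = h (f vs)"
      using E unfolding exterior_power_def by blast
    have hg: "Vector_Spaces.linear sW (*) (\<lambda>x. h (g x))"
      using Vector_Spaces.linear_compose[OF g h] by (simp add: o_def)
    have "\<And>b. b \<in> B \<Longrightarrow> h (g b) = k b" using gB r kw by metis
    then have "h (g (wedge vs)) = k (wedge vs)"
      using Q.linear_eq_on[OF hg k, of "wedge vs" B] spB by auto
    then show False using hx kw[OF vs] by (simp add: h.diff)
  qed
  then show "\<exists>g. Vector_Spaces.linear sW sU g \<and> (\<forall>vs. length vs = p \<longrightarrow> g (wedge vs) = f vs)"
    using g by blast
  fix g g'
  assume a: "Vector_Spaces.linear sW sU g \<and> (\<forall>vs. length vs = p \<longrightarrow> g (wedge vs) = f vs)"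
    and b: "Vector_Spaces.linear sW sU g' \<and> (\<forall>vs. length vs = p \<longrightarrow> g' (wedge vs) = f vs)"
  show "g = g'"
  proof
    fix x
    show "g x = g' x"
      by (rule P.linear_eq_on[of g g' x ?S]) (use a b sp in auto)
  qed
qed

subsection \<open>Symmetric bilinear forms and isotropic subspaces\<close>

definition bilinear_form ::
  "('k::field \<Rightarrow> 'v::ab_group_add \<Rightarrow> 'v) \<Rightarrow> ('v \<Rightarrow> 'v \<Rightarrow> 'k) \<Rightarrow> bool" where
  "bilinear_form s B \<longleftrightarrow>
     (\<forall>x. Vector_Spaces.linear s (*) (\<lambda>y. B x y)) \<and> (\<forall>y. Vector_Spaces.linear s (*) (\<lambda>x. B x y))"

definition symmetric_form :: "('v \<Rightarrow> 'v \<Rightarrow> 'k) \<Rightarrow> bool" where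
  "symmetric_form B \<longleftrightarrow> (\<forall>x y. B x y = B y x)"

text \<open>For symmetric forms left and right nondegeneracy agree.\<close>

definition nondegenerate_form :: "('v::zero \<Rightarrow> 'v \<Rightarrow> 'k::zero) \<Rightarrow> bool" where
  "nondegenerate_form B \<longleftrightarrow> (\<forall>x. (\<forall>y. B x y = 0) \<longrightarrow> x = 0)"

definition isotropic_subspace ::
  "('k::field \<Rightarrow> 'v::ab_group_add \<Rightarrow> 'v) \<Rightarrow> ('v \<Rightarrow> 'v \<Rightarrow> 'k) \<Rightarrow> 'v set \<Rightarrow> bool" where
  "isotropic_subspace s B L \<longleftrightarrow> module.subspace s L \<and> (\<forall>u\<in>L. \<forall>w\<in>L. B u w = 0)"

definition maximal_isotropic_subspace ::
  "('k::field \<Rightarrow> 'v::ab_group_add \<Rightarrow> 'v) \<Rightarrow> ('v \<Rightarrow> 'v \<Rightarrow> 'k) \<Rightarrow> 'v set \<Rightarrow> bool" where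
  "maximal_isotropic_subspace s B L \<longleftrightarrow>
     isotropic_subspace s B L \<and> (\<forall>M. isotropic_subspace s B M \<longrightarrow> L \<subseteq> M \<longrightarrow> M = L)"

text \<open>\<open>r\<close> is the common dimension of all maximal isotropic subspaces.\<close>

definition has_witt_index ::
  "('k::field \<Rightarrow> 'v::ab_group_add \<Rightarrow> 'v) \<Rightarrow> ('v \<Rightarrow> 'v \<Rightarrow> 'k) \<Rightarrow> nat \<Rightarrow> bool" where
  "has_witt_index s B r \<longleftrightarrow>
     (\<exists>L. maximal_isotropic_subspace s B L) \<and>
     (\<forall>L. maximal_isotropic_subspace s B L \<longrightarrow> vector_space.dim s L = r)"

subsection \<open>The isotropic Grassmann cone and its two components\<close>

definition isotropic_tuple :: "('v \<Rightarrow> 'v \<Rightarrow> 'k::zero) \<Rightarrow> nat \<Rightarrow> 'v list \<Rightarrow> bool" where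
  "isotropic_tuple B p vs \<longleftrightarrow> length vs = p \<and> (\<forall>i<p. \<forall>j<p. B (vs ! i) (vs ! j) = 0)"

definition Gr_iso :: "('v \<Rightarrow> 'v \<Rightarrow> 'k::zero) \<Rightarrow> nat \<Rightarrow> ('v list \<Rightarrow> 'w) \<Rightarrow> 'w set" where
  "Gr_iso B p wedge = {wedge vs | vs. isotropic_tuple B p vs}"

text \<open>
  For \<open>dim V = 2p\<close>: two nonzero points of the cone lie in the same irreducible component iff the
  isotropic subspaces they represent belong to the same of the two families of maximal isotropic
  subspaces, i.e. iff these subspaces meet in a dimension congruent to \<open>p\<close> modulo 2. (The span of the
  \<open>v\<^sub>i\<close> does not depend on the choice of the \<open>v\<^sub>i\<close> with \<open>v\<^sub>1 \<and> \<dots> \<and> v\<^sub>p = x\<close> when \<open>x \<noteq> 0\<close>.)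
  A component consists of the cone points in one family together with \<open>0\<close>. These are the
  \<open>K\<close>-points of the components of the variety; over a finite field the Zariski topology
  on the set of \<open>K\<close>-points is discrete and does not see them.
\<close>

definition same_family ::
  "('k::field \<Rightarrow> 'v::ab_group_add \<Rightarrow> 'v) \<Rightarrow> ('v \<Rightarrow> 'v \<Rightarrow> 'k) \<Rightarrow> nat \<Rightarrow> ('v list \<Rightarrow> 'w::zero)
    \<Rightarrow> 'w \<Rightarrow> 'w \<Rightarrow> bool" where
  "same_family s B p wedge x y \<longleftrightarrow>
     x \<noteq> 0 \<and> y \<noteq> 0 \<and>
     (\<exists>vs ws. isotropic_tuple B p vs \<and> isotropic_tuple B p ws \<and> x = wedge vs \<and> y = wedge ws \<and>
        [vector_space.dim s (module.span s (set vs) \<inter> module.span s (set ws)) = p] (mod 2))"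

definition Gr_iso_components ::
  "('k::field \<Rightarrow> 'v::ab_group_add \<Rightarrow> 'v) \<Rightarrow> ('v \<Rightarrow> 'v \<Rightarrow> 'k) \<Rightarrow> nat \<Rightarrow> ('v list \<Rightarrow> 'w::zero)
    \<Rightarrow> 'w set set" where
  "Gr_iso_components s B p wedge =
     {insert 0 {y. same_family s B p wedge x y} | x. x \<in> Gr_iso B p wedge - {0}}"

subsection \<open>Quadrics and zero loci\<close>

text \<open>
  A quadric is treated as the function it defines. Nothing is lost: a field of characteristic not 2 has
  at least three elements, so a homogeneous quadratic polynomial over it is determined by its values.
\<close>

definition quadratic_form ::
  "('k::field \<Rightarrow> 'w::ab_group_add \<Rightarrow> 'w) \<Rightarrow> ('w \<Rightarrow> 'k) \<Rightarrow> bool" where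
  "quadratic_form s q \<longleftrightarrow> (\<exists>b. bilinear_form s b \<and> (\<forall>x. q x = b x x))"

definition associated_form :: "('w::ab_group_add \<Rightarrow> 'k::field) \<Rightarrow> 'w \<Rightarrow> 'w \<Rightarrow> 'k" where
  "associated_form q x y = (q (x + y) - q x - q y) / 2"

text \<open>
  The rank of a bilinear form is the rank of the map \<open>x \<mapsto> b x -\<close> into the dual space; the dimension
  is taken in the space of all functions with pointwise operations.
\<close>

definition bilinear_form_rank :: "('w \<Rightarrow> 'w \<Rightarrow> 'k::field) \<Rightarrow> nat" where
  "bilinear_form_rank b =
     vector_space.dim (\<lambda>(c::'k) (f :: 'w \<Rightarrow> 'k) x. c * f x) (range b)"

definition quadric_rank :: "('w::ab_group_add \<Rightarrow> 'k::field) \<Rightarrow> nat" where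
  "quadric_rank q = bilinear_form_rank (associated_form q)"

definition zero_locus :: "('w \<Rightarrow> 'k::zero) set \<Rightarrow> 'w set" where
  "zero_locus F = {x. \<forall>f\<in>F. f x = 0}"

end

theory Submission
  imports Defs
begin

text \<open>
  Let \<open>S\<close> be the spinor space, of dimension \<open>2^p\<close>, on which \<open>V\<close> acts by operators \<open>g v\<close> with
  \<open>g v * g v = B v v\<close>. Antisymmetrising products gives an injective linear map \<open>rho\<close> from the \<open>p\<close>-th
  exterior power to the endomorphisms of \<open>S\<close>, and \<open>w\<close> lies on the cone iff \<open>rho w\<close> has rank
  at most one. The \<open>2 \<times> 2\<close> minors of \<open>rho w\<close> are quadrics of rank at most 4.

  An isotropic decomposable \<open>w\<close> is sent to a multiple of the product of the \<open>g v\<^sub>i\<close>. Its range is killed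
  by all \<open>g v\<^sub>i\<close>, and each additional independent isotropic vector halves the space of killed spinors.

  Conversely, let \<open>x = rho w \<noteq> 0\<close> have rank one and put \<open>N = {v. g v * x = 0}\<close>. For an orthogonal basis \<open>U\<close> of \<open>V\<close>,
  \<open>rho w\<close> is an eigenvector of the Casimir operator \<open>x \<mapsto> (\<Sum>u\<in>U. g u * x * g u / B u u)\<close>. This eigenvalue
  equation implies \<open>g v * x = 0 \<longleftrightarrow> x * g v = 0\<close>, and for \<open>x\<close> of rank one it places enough vectors in \<open>N\<close> to
  show \<open>x * g v\<close> proportional to \<open>x\<close> for all \<open>v\<close> orthogonal to \<open>N\<close>. If moreover \<open>B v v = 0\<close> the factor
  vanishes, so \<open>N\<close> is a maximal isotropic subspace; it has dimension \<open>p\<close>, and \<open>x\<close> is a multiple of the product of a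
  basis of \<open>N\<close>.

  If \<open>dim V = 2 p\<close>, the parity operator of \<open>S\<close> anticommutes with all \<open>g v\<close> and acts on the line of spinors killed by a
  maximal isotropic subspace by a sign; this sign distinguishes the two families, which yields the linear forms.
\<close>

section \<open>Quadratic spaces\<close>

locale quadratic_space = V: finite_dimensional_vector_space sV Basis
  for sV :: "'k::field \<Rightarrow> 'v::ab_group_add \<Rightarrow> 'v" and Basis +
  fixes B :: "'v \<Rightarrow> 'v \<Rightarrow> 'k"
  assumes bil: "bilinear_form sV B" and sym: "symmetric_form B"
    and nondegenerate: "nondegenerate_form B" and two: "(2::'k) \<noteq> 0"
begin

lemma B_linear_right: "Vector_Spaces.linear sV (*) (B x)"
  and B_linear_left: "Vector_Spaces.linear sV (*) (\<lambda>x. B x y)"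
  using bil by (auto simp: bilinear_form_def)

lemma B_sym: "B x y = B y x"
  using sym by (simp add: symmetric_form_def)

lemma B_simps [simp]:
  "B (x + y) z = B x z + B y z" "B x (y + z) = B x y + B x z"
  "B (x - y) z = B x z - B y z" "B x (y - z) = B x y - B x z"
  "B (sV c x) z = c * B x z" "B x (sV c z) = c * B x z"
  "B 0 x = 0" "B x 0 = 0" "B (- x) z = - B x z" "B x (- z) = - B x z"
  "B (sum h A) z = (\<Sum>a\<in>A. B (h a) z)" "B x (sum h A) = (\<Sum>a\<in>A. B x (h a))"
proof -
  interpret r: Vector_Spaces.linear sV "(*)" "B u" for u by (rule B_linear_right)
  interpret l: Vector_Spaces.linear sV "(*)" "\<lambda>x. B x u" for u by (rule B_linear_left)
  show "B (x + y) z = B x z + B y z" "B x (y + z) = B x y + B x z"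
  "B (x - y) z = B x z - B y z" "B x (y - z) = B x y - B x z"
  "B (sV c x) z = c * B x z" "B x (sV c z) = c * B x z"
  "B 0 x = 0" "B x 0 = 0" "B (- x) z = - B x z" "B x (- z) = - B x z"
  "B (sum h A) z = (\<Sum>a\<in>A. B (h a) z)" "B x (sum h A) = (\<Sum>a\<in>A. B x (h a))"
    using l.add r.add l.diff r.diff l.scale r.scale l.zero r.zero l.neg r.neg l.sum r.sum by auto
qed

lemma subspace_orthogonal_single: "V.subspace {v. B x v = 0}"
  by (auto simp: V.subspace_def)

lemma orthogonal_span:
  assumes "\<And>x. x \<in> A \<Longrightarrow> B v x = 0" "y \<in> V.span A"
  shows "B v y = 0"
  using V.span_minimal[OF _ subspace_orthogonal_single, of A v] assms by auto

text \<open>Recursion along the list matches the recursion of the Clifford products below.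
  \<open>orthogonal_list\<close> leaves the values \<open>B v v\<close> free, so it covers both
  isotropic tuples and lists of anisotropic frame vectors.\<close>

primrec orthogonal_list :: "'v list \<Rightarrow> bool" where
  "orthogonal_list [] \<longleftrightarrow> True"
| "orthogonal_list (v # vs) \<longleftrightarrow> (\<forall>w\<in>set vs. B v w = 0) \<and> orthogonal_list vs"

primrec independent_list :: "'v list \<Rightarrow> bool" where
  "independent_list [] \<longleftrightarrow> True"
| "independent_list (v # vs) \<longleftrightarrow> v \<notin> V.span (set vs) \<and> independent_list vs"

definition isotropic_set :: "'v set \<Rightarrow> bool" where
  "isotropic_set A \<longleftrightarrow> (\<forall>x\<in>A. \<forall>y\<in>A. B x y = 0)"

lemma isotropic_tuple_iff: "isotropic_tuple B q vs \<longleftrightarrow> length vs = q \<and> isotropic_set (set vs)"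
  by (auto simp: isotropic_tuple_def isotropic_set_def all_set_conv_all_nth)

lemma isotropic_set_orthogonal_list: "isotropic_set (set vs) \<Longrightarrow> orthogonal_list vs"
  by (induction vs) (auto simp: isotropic_set_def)

lemma isotropic_set_span: "isotropic_set A \<Longrightarrow> isotropic_subspace sV B (V.span A)"
proof -
  assume a: "isotropic_set A"
  have "B x y = 0" if "x \<in> A" "y \<in> V.span A" for x y
    using orthogonal_span[OF _ that(2), of x] a that by (auto simp: isotropic_set_def)
  then have "B y z = 0" if "y \<in> V.span A" "z \<in> V.span A" for y z
    using orthogonal_span[OF _ that(2), of y] that by (metis B_sym)
  then show ?thesis by (auto simp: isotropic_subspace_def V.subspace_span)
qed

text \<open>The map \<open>t\<close> records the values of \<open>B v\<close> on the basis as
  coordinates. Nondegeneracy makes it injective, hence surjective in finite dimension, so any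
  prescribed values of \<open>h\<close> on the basis are attained.\<close>

lemma represent_functional:
  assumes "Vector_Spaces.linear sV (*) h"
  obtains f where "\<And>v. B f v = h v"
proof -
  interpret h: Vector_Spaces.linear sV "(*)" h by fact
  interpret vp: finite_dimensional_vector_space_pair sV Basis sV Basis by unfold_locales
  interpret vk: vector_space_pair sV "(*) :: 'k \<Rightarrow> 'k \<Rightarrow> 'k"
    by (intro vector_space_pair.intro V.vector_space_axioms vector_space_field)
  define t where "t v = (\<Sum>b\<in>Basis. sV (B v b) b)" for v
  have lin: "Vector_Spaces.linear sV sV t"
    by (auto simp: Vector_Spaces.linear_iff V.vector_space_axioms t_def V.scale_left_distrib sum.distrib V.scale_sum_right)
  interpret t: Vector_Spaces.linear sV sV t by (rule lin)
  have coeff: "c b = 0" if "(\<Sum>b\<in>Basis. sV (c b) b) = 0" "b \<in> Basis" for c b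
    using V.independent_Basis V.finite_Basis that unfolding V.dependent_finite[OF V.finite_Basis] by blast
  have eq: "B v w = h w" if "\<And>b. b \<in> Basis \<Longrightarrow> B v b = h b" for v w
    by (rule vk.linear_eq_on[OF B_linear_right assms, of _ Basis]) (use that V.span_Basis in auto)
  have "v = 0" if "t v = 0" for v
  proof -
    have "B v b = 0" if "b \<in> Basis" for b using coeff \<open>t v = 0\<close> that by (auto simp: t_def)
    then have "\<forall>w. B v w = 0" using orthogonal_span[of Basis v] V.span_Basis by auto
    then show ?thesis using nondegenerate by (auto simp: nondegenerate_form_def)
  qed
  then have "inj t" using t.inj_iff_eq_0 by simp
  then have "surj t" using vp.linear_injective_imp_surjective[OF lin] by auto
  then obtain f where "t f = (\<Sum>b\<in>Basis. sV (h b) b)" by (metis surjD)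
  then have "(\<Sum>b\<in>Basis. sV (B f b - h b) b) = 0"
    by (simp add: t_def V.scale_left_diff_distrib sum_subtractf)
  from coeff[OF this] have "B f b = h b" if "b \<in> Basis" for b using that by simp
  then have "B f w = h w" for w by (rule eq)
  then show ?thesis using that by blast
qed

text \<open>Extend the functional with value 1 at \<open>x\<close> and 0 on a basis of the span,
  then represent it by a vector. The resulting \<open>f\<close> is the partner used whenever a
  vector is peeled off an independent list.\<close>

lemma separate_from_span:
  assumes "x \<notin> V.span A"
  obtains f where "B f x = 1" "\<And>a. a \<in> A \<Longrightarrow> B f a = 0"
proof -
  interpret vk: vector_space_pair sV "(*) :: 'k \<Rightarrow> 'k \<Rightarrow> 'k"
    by (intro vector_space_pair.intro V.vector_space_axioms vector_space_field)
  obtain A' where A': "A' \<subseteq> A" "V.independent A'" "A \<subseteq> V.span A'"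
    using V.maximal_independent_subset by blast
  have x: "x \<notin> V.span A'" using assms A'(1) V.span_mono by blast
  then have "V.independent (insert x A')" using A' by (simp add: V.independent_insert)
  then obtain h where h: "Vector_Spaces.linear sV (*) h"
    "\<forall>y\<in>insert x A'. h y = (if y = x then 1 else 0)"
    using vk.linear_independent_extend[of "insert x A'" "\<lambda>y. if y = x then 1 else 0"] by blast
  have "x \<notin> A'" using x V.span_base by blast
  then have "\<And>y. y \<in> A' \<Longrightarrow> h y = 0" using h(2) by auto
  then have "h a = 0" if "a \<in> A" for a
    using vk.linear_eq_0_on_span[OF h(1), of A' a] A'(3) that by auto
  moreover have "h x = 1" using h by auto
  moreover obtain f where "\<And>v. B f v = h v" using represent_functional[OF h(1)] by blast
  ultimately show ?thesis using that by metis
qed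

lemma independent_list_iff: "independent_list vs \<longleftrightarrow> distinct vs \<and> V.independent (set vs)"
  by (induction vs) (auto simp: V.independent_insert V.span_base V.independent_empty)

end

section \<open>Hyperbolic normal form of a quadratic space of maximal Witt index\<close>

context quadratic_space begin

text \<open>Adjoining \<open>v\<close> to \<open>L\<close> keeps the span isotropic, so maximality
  leaves no room for a new vector.\<close>

lemma isotropic_anisotropic_complement:
  assumes "maximal_isotropic_subspace sV B L" "\<And>w. w \<in> L \<Longrightarrow> B v w = 0" "B v v = 0"
  shows "v \<in> L"
proof -
  have L: "isotropic_subspace sV B L" "V.subspace L" "\<And>M. isotropic_subspace sV B M \<Longrightarrow> L \<subseteq> M \<Longrightarrow> M = L"
    using assms(1) by (auto simp: maximal_isotropic_subspace_def isotropic_subspace_def)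
  have "isotropic_set (insert v L)"
    using L(1) assms(2,3) by (auto simp: isotropic_set_def isotropic_subspace_def B_sym)
  then have "V.span (insert v L) = L"
    by (intro L(3) isotropic_set_span) (auto intro: V.span_base)
  then show ?thesis using V.span_base by blast
qed

lemma orthogonal_anisotropic_independent:
  assumes "finite A" "\<And>u. u \<in> A \<Longrightarrow> B u u \<noteq> 0" "\<And>u w. u \<in> A \<Longrightarrow> w \<in> A \<Longrightarrow> u \<noteq> w \<Longrightarrow> B u w = 0"
  shows "V.independent A"
  unfolding V.dependent_def
proof safe
  fix u assume u: "u \<in> A" "u \<in> V.span (A - {u})"
  then have "B u u = 0" using assms(3) by (intro orthogonal_span[OF _ u(2)]) auto
  then show False using assms(2) u by blast
qed

text \<open>If \<open>r = 0\<close>, the last summand of the normal form is \<open>0 / 0 = 0\<close>.\<close>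

lemma hyperbolic_normal_form:
  assumes witt: "has_witt_index sV B p" and dim: "V.dim UNIV \<le> 2 * p + 1"
  obtains U r and a b :: "nat \<Rightarrow> 'v" where
    "finite U" "\<And>u. u \<in> U \<Longrightarrow> B u u \<noteq> 0" "\<And>u w. u \<in> U \<Longrightarrow> w \<in> U \<Longrightarrow> u \<noteq> w \<Longrightarrow> B u w = 0"
    "V.span U = UNIV"
    "\<And>v. B v v = (\<Sum>i<p. 2 * B v (a i) * B v (b i)) + (B v r)\<^sup>2 / B r r"
    "r \<noteq> 0 \<Longrightarrow> B r r \<noteq> 0" "V.dim UNIV = 2 * p \<Longrightarrow> r = 0"
proof -
  obtain L where L: "maximal_isotropic_subspace sV B L" "V.dim L = p"
    using witt by (auto simp: has_witt_index_def)
  obtain T where T: "T \<subseteq> L" "V.independent T" "L \<subseteq> V.span T" "card T = p"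
    using V.basis_exists[of L] L(2) by metis
  then have "finite T" using V.finiteI_independent by blast
  then obtain h where h: "bij_betw h {..<p} T"
    using T(4) ex_bij_betw_nat_finite[of T] by (auto simp: atLeast0LessThan)
  define e where "e i = h i" for i
  have eT: "e ` {..<p} = T" and e_inj: "inj_on e {..<p}" using h by (auto simp: e_def[abs_def] bij_betw_def)
  have "B x y = 0" if "x \<in> T" "y \<in> T" for x y
    using that T(1) L(1) by (auto simp: maximal_isotropic_subspace_def isotropic_subspace_def)
  then have ee: "B (e i) (e j) = 0" if "i < p" "j < p" for i j
    using eT that by auto
  have "\<exists>f. \<forall>j<p. B f (e j) = (if i = j then 1 else 0)" if "i < p" for i
  proof -
    have "e i \<in> T" using eT that by blast
    then have "e i \<notin> V.span (T - {e i})" using T(2) by (auto simp: V.dependent_def)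
    then obtain f where f: "B f (e i) = 1" "\<And>x. x \<in> T - {e i} \<Longrightarrow> B f x = 0"
      using separate_from_span by blast
    have "B f (e j) = 0" if "j < p" "i \<noteq> j" for j
      using eT e_inj that \<open>i < p\<close> by (intro f(2)) (auto simp: inj_on_def)
    then show ?thesis using f by (intro exI[of _ f]) auto
  qed
  then obtain f0 where f0: "\<And>i j. i < p \<Longrightarrow> j < p \<Longrightarrow> B (f0 i) (e j) = (if i = j then 1 else 0)"
    by metis
  \<comment> \<open>The vectors \<open>f0 i\<close> are dual to the \<open>e i\<close> but not
    isotropic. Subtracting half of their Gram matrix along the \<open>e k\<close> cancels
    \<open>B (f i) (f j)\<close> and, as the \<open>e k\<close> are mutually orthogonal, preserves
    duality.\<close>
  define f where "f i = f0 i - (\<Sum>k<p. sV (B (f0 i) (f0 k) / 2) (e k))" for i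
  have fe: "B (f i) (e j) = (if i = j then 1 else 0)" if "i < p" "j < p" for i j
    using that by (simp add: f_def f0 ee)
  have ef: "B (e j) (f i) = (if i = j then 1 else 0)" if "i < p" "j < p" for i j
    using fe[OF that] by (simp add: B_sym)
  have ff: "B (f i) (f j) = 0" if ij: "i < p" "j < p" for i j
  proof -
    have "B (f i) (f j) = B (f i) (f0 j) - (\<Sum>k<p. B (f0 j) (f0 k) / 2 * B (f i) (e k))"
      by (subst f_def[of j]) simp
    also have "(\<Sum>k<p. B (f0 j) (f0 k) / 2 * B (f i) (e k)) = (\<Sum>k<p. if i = k then B (f0 j) (f0 k) / 2 else 0)"
      using ij by (intro sum.cong) (auto simp: fe)
    also have "\<dots> = B (f0 j) (f0 i) / 2" using ij by simp
    also have "B (f i) (f0 j) = B (f0 i) (f0 j) - (\<Sum>k<p. B (f0 i) (f0 k) / 2 * B (e k) (f0 j))"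
      by (subst f_def) simp
    also have "(\<Sum>k<p. B (f0 i) (f0 k) / 2 * B (e k) (f0 j)) = (\<Sum>k<p. if j = k then B (f0 i) (f0 k) / 2 else 0)"
      using ij by (intro sum.cong) (auto simp: f0 B_sym[of "e _"])
    also have "\<dots> = B (f0 i) (f0 j) / 2" using ij by simp
    finally show ?thesis using two by (simp add: B_sym[of "f0 j"] field_simps)
  qed
  \<comment> \<open>\<open>q\<close> is the orthogonal projection onto the hyperbolic part spanned
    by the \<open>e i\<close> and \<open>f i\<close>; \<open>R\<close> is the orthogonal complement
    of that part.\<close>
  define q where "q v = (\<Sum>i<p. sV (B v (f i)) (e i) + sV (B v (e i)) (f i))" for v
  define R where "R = {v. \<forall>i<p. B v (e i) = 0 \<and> B v (f i) = 0}"
  have R_diff: "v - q v \<in> R" for v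
  proof -
    have "B (q v) (e j) = B v (e j)" "B (q v) (f j) = B v (f j)" if j: "j < p" for j
    proof -
      have "B (q v) (e j) = (\<Sum>i<p. if i = j then B v (e j) else 0)"
        unfolding q_def B_simps using j by (intro sum.cong) (auto simp: ee fe)
      then show "B (q v) (e j) = B v (e j)" using j by simp
      have "B (q v) (f j) = (\<Sum>i<p. if i = j then B v (f j) else 0)"
        unfolding q_def B_simps using j by (intro sum.cong) (auto simp: ff ef)
      then show "B (q v) (f j) = B v (f j)" using j by simp
    qed
    then show ?thesis by (simp add: R_def)
  qed
  \<comment> \<open>\<open>R\<close> is orthogonal to \<open>L\<close>, so an isotropic
    \<open>v\<close> in \<open>R\<close> lies in \<open>L\<close> by maximality. It is then
    orthogonal to \<open>R\<close> and to the hyperbolic part, hence zero.\<close>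
  have R_anisotropic: "v = 0" if v: "v \<in> R" "B v v = 0" for v
  proof -
    have ve: "B v w = 0" if "w \<in> L" for w
      using orthogonal_span[of T v w] T(3) that v(1) eT by (auto simp: R_def)
    have vL: "v \<in> L" by (rule isotropic_anisotropic_complement[OF L(1) ve v(2)])
    have "B v y = 0" for y
    proof -
      have "B v y = B v (y - q y) + B v (q y)" by simp
      also have "B v (q y) = 0" using v(1) by (auto simp: q_def R_def)
      also have "B v (y - q y) = 0"
        using orthogonal_span[of T "y - q y" v] T(3) vL eT R_diff[of y] by (auto simp: R_def B_sym[of v])
      finally show ?thesis by simp
    qed
    then show ?thesis using nondegenerate by (auto simp: nondegenerate_form_def)
  qed
  \<comment> \<open>Each hyperbolic plane has the orthogonal basis \<open>e i + f i\<close>,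
    \<open>e i - f i\<close>, on which the form takes the values 2 and -2.\<close>
  define U0 where "U0 = (\<lambda>i. e i + f i) ` {..<p} \<union> (\<lambda>i. e i - f i) ` {..<p}"
  have U0_fin: "finite U0" by (simp add: U0_def)
  have U0_ne: "B u u \<noteq> 0" if "u \<in> U0" for u
    using that two by (auto simp: U0_def ee ef fe ff)
  have U0_orth: "B u w = 0" if "u \<in> U0" "w \<in> U0" "u \<noteq> w" for u w
    using that by (auto simp: U0_def ee ef fe ff)
  have U0_R: "B u v = 0" "B v u = 0" if "u \<in> U0" "v \<in> R" for u v
    using that B_sym[of u v] by (auto simp: U0_def R_def)
  have U0_card: "card U0 = 2 * p"
  proof -
    have inj: "inj_on (\<lambda>i. e i + f i) {..<p}"
    proof (rule inj_onI, rule ccontr)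
      fix i j assume ij: "i \<in> {..<p}" "j \<in> {..<p}" "e i + f i = e j + f j" "i \<noteq> j"
      have "B (e i + f i) (e i + f i) = 2" "B (e i + f i) (e j + f j) = 0"
        using ij(1,2,4) by (simp_all add: ee ef fe ff)
      then show False using ij(3) two by metis
    qed
    have inj': "inj_on (\<lambda>i. e i - f i) {..<p}"
    proof (rule inj_onI, rule ccontr)
      fix i j assume ij: "i \<in> {..<p}" "j \<in> {..<p}" "e i - f i = e j - f j" "i \<noteq> j"
      have "B (e i - f i) (e i - f i) = - 2" "B (e i - f i) (e j - f j) = 0"
        using ij(1,2,4) by (simp_all add: ee ef fe ff)
      then show False using ij(3) two by (metis neg_equal_0_iff_equal)
    qed
    have "(\<lambda>i. e i + f i) ` {..<p} \<inter> (\<lambda>i. e i - f i) ` {..<p} = {}"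
    proof (rule ccontr)
      assume "\<not> ?thesis"
      then obtain i j where ij: "i < p" "j < p" "e i + f i = e j - f j" by blast
      have "B (e i + f i) (e i + f i) = 2" "B (e i + f i) (e j - f j) = 0"
        using ij(1,2) by (simp_all add: ee ef fe ff)
      then show False using ij(3) two by metis
    qed
    then show ?thesis unfolding U0_def using card_image[OF inj] card_image[OF inj'] by (subst card_Un_disjoint) auto
  qed
  have U0_span: "e i \<in> V.span U0" "f i \<in> V.span U0" if "i < p" for i
  proof -
    have s: "e i + f i \<in> V.span U0" "e i - f i \<in> V.span U0" using that by (auto simp: U0_def intro: V.span_base)
    have half: "sV (1/2) (x + x) = x" for x using two V.scale_left_distrib[of "1/2" "1/2" x] V.scale_right_distrib[of "1/2" x x] by simp
    have "sV (1/2) ((e i + f i) + (e i - f i)) \<in> V.span U0" using s V.span_add V.span_scale by blast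
    then show "e i \<in> V.span U0" using half[of "e i"] by (simp add: algebra_simps)
    have "sV (1/2) ((e i + f i) - (e i - f i)) \<in> V.span U0" using s V.span_diff V.span_scale by blast
    then show "f i \<in> V.span U0" using half[of "f i"] by (simp add: algebra_simps)
  qed
  have q_span: "q v \<in> V.span U0" for v
    unfolding q_def by (intro V.span_sum V.span_add V.span_scale U0_span) auto
  have Bq: "B v (q v) = (\<Sum>i<p. 2 * B v (f i) * B v (e i))" for v
    unfolding q_def B_simps by (intro sum.cong) (auto simp: algebra_simps)
  have card_le: "card A \<le> V.dim UNIV" if "finite A" "\<And>u. u \<in> A \<Longrightarrow> B u u \<noteq> 0" "\<And>u w. u \<in> A \<Longrightarrow> w \<in> A \<Longrightarrow> u \<noteq> w \<Longrightarrow> B u w = 0" for A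
    using V.independent_card_le_dim[of A UNIV] orthogonal_anisotropic_independent[OF that] by simp
  show ?thesis
  proof (cases "R = {0}")
    case True
    then have vq: "q v = v" for v using R_diff[of v] by simp
    show ?thesis
    proof (rule that[of U0 f e 0])
      show "V.span U0 = UNIV" using q_span vq by (metis UNIV_eq_I)
      show "B v v = (\<Sum>i<p. 2 * B v (f i) * B v (e i)) + (B v 0)\<^sup>2 / B 0 0" for v
        using Bq[of v] by (simp add: vq)
    qed (use U0_fin U0_ne U0_orth in auto)
  next
    case False
    moreover have "0 \<in> R" by (simp add: R_def)
    ultimately obtain r where r: "r \<in> R" "r \<noteq> 0" by blast
    have rr: "B r r \<noteq> 0" using R_anisotropic r by blast
    have notin: "v \<notin> U0" if "v \<in> R" for v using U0_R(1)[OF _ that] U0_ne by blast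
    let ?U = "insert r U0"
    have U: "finite ?U" "B u u \<noteq> 0" if "u \<in> ?U" for u using U0_fin U0_ne rr that by auto
    have U_orth: "B u w = 0" if "u \<in> ?U" "w \<in> ?U" "u \<noteq> w" for u w
      using that U0_orth U0_R r(1) by auto
    \<comment> \<open>\<open>R\<close> is a line: a part of \<open>v\<close> orthogonal to
      \<open>r\<close> would be anisotropic and would extend the frame to \<open>2 * p + 2\<close>
      independent vectors.\<close>
    have multiple: "v = sV (B v r / B r r) r" if "v \<in> R" for v
    proof (rule ccontr)
      assume ne: "v \<noteq> sV (B v r / B r r) r"
      define v' where "v' = v - sV (B v r / B r r) r"
      have "v' \<noteq> 0" using ne by (simp add: v'_def)
      moreover have "v' \<in> R" using that r(1) by (simp add: v'_def R_def)
      moreover have "B v' r = 0" using rr by (simp add: v'_def)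
      ultimately have v': "v' \<noteq> 0" "v' \<in> R" "B v' r = 0" "B r v' = 0"
        using B_sym[of r v'] by auto
      then have ne: "B v' v' \<noteq> 0" using R_anisotropic by blast
      have "v' \<noteq> r" using v'(3) rr by auto
      then have "card (insert v' ?U) = 2 * p + 2"
        using notin[OF v'(2)] notin[OF r(1)] U0_fin U0_card by simp
      moreover have "card (insert v' ?U) \<le> V.dim UNIV"
        by (rule card_le) (use ne v' U U_orth U0_R U0_fin in auto)
      ultimately show False using dim by simp
    qed
    have expand: "v = q v + sV (B v r / B r r) r" for v
    proof -
      have "B (v - q v) r = B v r" using r(1) by (simp add: q_def R_def B_sym[of _ r])
      then show ?thesis using multiple[OF R_diff[of v]] by (simp add: algebra_simps)
    qed
    have card: "card ?U = 2 * p + 1" using notin[OF r(1)] U0_fin U0_card by simp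
    show ?thesis
    proof (rule that[of ?U f e r])
      have "v \<in> V.span ?U" for v
      proof -
        have "q v \<in> V.span ?U" using q_span V.span_mono[of U0 ?U] by blast
        moreover have "sV (B v r / B r r) r \<in> V.span ?U" by (intro V.span_scale V.span_base) simp
        ultimately show ?thesis using expand[of v] V.span_add by metis
      qed
      then show "V.span ?U = UNIV" by blast
      show "B v v = (\<Sum>i<p. 2 * B v (f i) * B v (e i)) + (B v r)\<^sup>2 / B r r" for v
      proof -
        have "B v v = B v (q v + sV (B v r / B r r) r)" using expand[of v] by simp
        then show ?thesis by (simp add: Bq power2_eq_square)
      qed
      show "V.dim UNIV = 2 * p \<Longrightarrow> r = 0"
        using card_le[of ?U] card U U_orth U0_fin by auto
    qed (use U U_orth rr U0_fin in auto)
  qed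
qed

end

section \<open>Representations of the Clifford relations\<close>

text \<open>The ring is not assumed to have a unit: \<open>I\<close> will be the projection to a finite-dimensional spinor
  space inside an infinite-dimensional space of functions.\<close>

locale clifford_rep = quadratic_space sV Basis B + R: vector_space sR
  for sV :: "'k::field \<Rightarrow> 'v::ab_group_add \<Rightarrow> 'v" and Basis and B
    and sR :: "'k \<Rightarrow> 'r::ring \<Rightarrow> 'r" +
  fixes g :: "'v \<Rightarrow> 'r" and I :: 'r
  assumes scale_mult_left [simp]: "sR c x * y = sR c (x * y)"
    and scale_mult_right [simp]: "x * sR c y = sR c (x * y)"
    and g_linear: "Vector_Spaces.linear sV sR g"
    and g_square: "g v * g v = sR (B v v) I"
    and I_idem [simp]: "I * I = I"
    and I_g [simp]: "I * g v = g v" and g_I [simp]: "g v * I = g v"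
    and I_nonzero: "I \<noteq> 0"
    and prime: "(\<And>y. x * y * z = 0) \<Longrightarrow> x = 0 \<or> z = 0"
begin

lemma g_simps:
  "g (x + y) = g x + g y" "g (x - y) = g x - g y" "g (sV c x) = sR c (g x)" "g 0 = 0"
  "g (- x) = - g x" "g (sum h A) = (\<Sum>a\<in>A. g (h a))"
proof -
  interpret g: Vector_Spaces.linear sV sR g by (rule g_linear)
  show "g (x + y) = g x + g y" "g (x - y) = g x - g y" "g (sV c x) = sR c (g x)" "g 0 = 0"
  "g (- x) = - g x" "g (sum h A) = (\<Sum>a\<in>A. g (h a))"
    by (simp_all add: g.add g.diff g.scale g.zero g.neg g.sum)
qed

lemma clifford: "g v * g w + g w * g v = sR (2 * B v w) I"
proof -
  have "g (v + w) * g (v + w) = sR (B (v + w) (v + w)) I" by (rule g_square)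
  then have "(g v * g w + g w * g v) + (g v * g v + g w * g w)
    = sR (2 * B v w) I + (sR (B v v) I + sR (B w w) I)"
    by (simp add: g_simps algebra_simps B_sym[of w v] mult_2)
  then show ?thesis by (simp add: g_square)
qed

lemma clifford_swap: "g v * g w = sR (2 * B v w) I - g w * g v"
  using clifford[of v w] by (simp add: algebra_simps)

lemma anticommute: "B v w = 0 \<Longrightarrow> g v * g w = - (g w * g v)"
  using clifford_swap[of v w] by simp

lemma anticommute_left: "B v w = 0 \<Longrightarrow> g v * (g w * x) = - (g w * (g v * x))"
  using anticommute[of v w] by (simp add: mult.assoc[symmetric])

primrec P :: "'v list \<Rightarrow> 'r" where
  "P [] = I"
| "P (v # vs) = g v * P vs"

text \<open>\<open>Q\<close> is \<open>2^n\<close> times the antisymmetrised product of \<open>n\<close> vectors. Antisymmetrising one vector at a time by a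
  (graded) commutator avoids dividing by \<open>n!\<close>, which may be zero in the field.\<close>

primrec Q :: "'v list \<Rightarrow> 'r" where
  "Q [] = I"
| "Q (v # vs) = g v * Q vs + sR ((-1) ^ length vs) (Q vs * g v)"

lemma I_g_left [simp]: "I * (g v * x) = g v * x"
  by (simp flip: mult.assoc)

lemma I_P [simp]: "I * P vs = P vs"
  by (cases vs) simp_all

lemma I_Q [simp]: "I * Q vs = Q vs"
  by (induction vs) (simp_all add: distrib_left mult.assoc[symmetric, of I])

lemma Q_I [simp]: "Q vs * I = Q vs"
  by (induction vs) (simp_all add: distrib_right mult.assoc)

lemma scale_minus_one: "sR (- c) x = - sR c x" by (simp add: R.scale_minus_left)

lemma scale_two: "x + x = sR 2 x"
  using R.scale_left_distrib[of 1 1 x] by simp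

lemma P_commute: 
  assumes "\<And>w. w \<in> set vs \<Longrightarrow> B v w = 0"
  shows "P vs * g v = sR ((-1) ^ length vs) (g v * P vs)"
  using assms
proof (induction vs)
  case (Cons w vs)
  have "P (w # vs) * g v = sR ((-1) ^ length vs) (g w * g v * P vs)"
    using Cons by (simp add: mult.assoc)
  also have "g w * g v = - (g v * g w)"
    using anticommute[of w v] Cons.prems[of w] by (simp add: B_sym)
  finally show ?case by (simp add: mult.assoc R.scale_minus_left R.scale_minus_right)
qed simp

text \<open>For orthogonal vectors the sign in the graded commutator cancels the sign from moving
  \<open>g v\<close> past the product, so both summands agree and every step doubles.\<close>

lemma Q_orthogonal: "orthogonal_list vs \<Longrightarrow> Q vs = sR (2 ^ length vs) (P vs)"
proof (induction vs)
  case (Cons v vs)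
  then have "Q (v # vs) = sR (2 ^ length vs) (g v * P vs + sR ((-1) ^ length vs) (P vs * g v))"
    by (simp add: R.scale_right_distrib mult.commute)
  also have "P vs * g v = sR ((-1) ^ length vs) (g v * P vs)"
    using Cons by (intro P_commute) auto
  finally show ?case
    using scale_two[of "g v * P vs"] by (simp add: mult.commute)
qed simp

lemma Q_linear_nth: "i < length vs \<Longrightarrow> Vector_Spaces.linear sV sR (\<lambda>x. Q (vs[i := x]))"
proof (induction vs arbitrary: i)
  case (Cons v vs)
  interpret vector_space_pair sV sR by unfold_locales
  show ?case
  proof (cases i)
    case 0
    then show ?thesis
      by (auto intro!: Vector_Spaces.linear_iff[THEN iffD2] simp: V.vector_space_axioms R.vector_space_axioms
          g_simps algebra_simps R.scale_right_distrib mult.commute)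
  next
    case (Suc j)
    interpret j: Vector_Spaces.linear sV sR "\<lambda>x. Q (vs[j := x])"
      using Cons Suc by simp
    show ?thesis using Suc
      by (auto intro!: Vector_Spaces.linear_iff[THEN iffD2] simp: V.vector_space_axioms R.vector_space_axioms
          g_simps algebra_simps R.scale_right_distrib j.add j.scale mult.commute)
  qed
qed simp

text \<open>The two mixed terms \<open>g v * Q vs * g v\<close> carry opposite signs because the
  list lengths differ by one; the outer terms cancel because \<open>g v * g v\<close> is a multiple
  of \<open>I\<close> and so commutes with \<open>Q vs\<close>.\<close>

lemma Q_Cons_Cons_same: "Q (v # v # vs) = 0"
proof -
  have "g v * (g v * Q vs) = Q vs * g v * g v"
    by (simp add: mult.assoc[symmetric] g_square) (simp add: mult.assoc g_square)
  then show ?thesis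
    by (simp add: algebra_simps R.scale_right_distrib scale_minus_one)
qed

lemma Q_swap: "Q (v # w # vs) = - Q (w # v # vs)"
proof -
  have "Q ((v + w) # (v + w) # vs) = 0" by (rule Q_Cons_Cons_same)
  then have "Q (v # v # vs) + Q (v # w # vs) + Q (w # v # vs) + Q (w # w # vs) = 0"
    by (simp add: g_simps algebra_simps R.scale_right_distrib)
  then show ?thesis
    unfolding Q_Cons_Cons_same by (simp only: eq_neg_iff_add_eq_0 add_0_left add_0_right)
qed

text \<open>Swaps carry the front copy of \<open>v\<close> inwards until it stands next to the other
  one.\<close>

lemma Q_Cons_member: "v \<in> set vs \<Longrightarrow> Q (v # vs) = 0"
proof (induction vs)
  case (Cons w vs)
  show ?case
  proof (cases "v = w")
    case False
    then have "Q (v # vs) = 0" using Cons by simp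
    then have "Q (w # v # vs) = 0" by (simp only: Q.simps(2)[of w]) simp
    then show ?thesis using Q_swap by simp
  qed (simp only: Q_Cons_Cons_same)
qed simp

lemma Q_not_distinct: "\<not> distinct vs \<Longrightarrow> Q vs = 0"
proof (induction vs)
  case (Cons v vs)
  then show ?case using Q_Cons_member[of v vs] by (cases "v \<in> set vs") auto
qed simp

text \<open>This is what lets \<open>Q\<close> descend to a linear map on the exterior
  power.\<close>

lemma Q_alternating: "alternating_multilinear sV sR q Q"
  unfolding alternating_multilinear_def
proof (intro conjI allI impI)
  fix vs :: "'v list" and i j
  assume "length vs = q" "i < j" "j < q" "vs ! i = vs ! j"
  then show "Q vs = 0" by (intro Q_not_distinct) (metis distinct_conv_nth less_irrefl order.strict_trans)
qed (auto intro: Q_linear_nth)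

end

section \<open>Products of isotropic vectors and their annihilators\<close>

context clifford_rep begin

text \<open>Dividing by \<open>B u u\<close> turns an orthogonal basis into its dual basis, so
  \<open>x\<close> is multiplied on both sides by the two legs of the inverse form.\<close>

definition casimir :: "'v set \<Rightarrow> 'r \<Rightarrow> 'r" where
  "casimir U x = (\<Sum>u\<in>U. sR (1 / B u u) (g u * x * g u))"

lemma g_self_left: "g u * (g u * x) = sR (B u u) (I * x)"
  by (simp add: g_square flip: mult.assoc)

lemma isotropic_set_Cons: "isotropic_set (set (v # vs)) \<Longrightarrow> isotropic_set (set vs) \<and> B v v = 0 \<and> (\<forall>w\<in>set vs. B v w = 0)"
  by (auto simp: isotropic_set_def)

lemma subspace_left_annihilator: "V.subspace {v. g v * x = 0}"
  by (auto simp: V.subspace_def g_simps distrib_right)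

text \<open>Anticommute \<open>g v\<close> to the right until it meets its own factor, where
  \<open>g v * g v = 0\<close>; linearity in \<open>v\<close> extends this to the span.\<close>

lemma P_left_annihilated:
  "isotropic_set (set vs) \<Longrightarrow> v \<in> V.span (set vs) \<Longrightarrow> g v * P vs = 0"
proof -
  have *: "v \<in> set vs \<Longrightarrow> isotropic_set (set vs) \<Longrightarrow> g v * P vs = 0" for v
  proof (induction vs)
    case (Cons w vs)
    note iso = isotropic_set_Cons[OF Cons.prems(2)]
    show ?case
    proof (cases "v = w")
      case True
      then show ?thesis using iso by (simp add: g_self_left)
    next
      case False
      then have "B v w = 0" "g v * P vs = 0" using Cons iso by (auto simp: B_sym)
      then show ?thesis using anticommute_left[of v w] by simp
    qed
  qed simp
  assume "isotropic_set (set vs)" "v \<in> V.span (set vs)"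
  then show ?thesis
    using V.span_minimal[OF _ subspace_left_annihilator, of "set vs" "P vs"] * by auto
qed

lemma P_dependent:
  "isotropic_set (set vs) \<Longrightarrow> \<not> independent_list vs \<Longrightarrow> P vs = 0"
proof (induction vs)
  case (Cons v vs)
  then show ?case using isotropic_set_Cons[of v vs] P_left_annihilated[of vs v]
    by (cases "v \<in> V.span (set vs)") auto
qed simp

text \<open>For such a pair the Clifford relation writes \<open>I\<close> as half the sum of the two
  products. If \<open>g v\<close> kills \<open>x\<close>, only \<open>g v * (g f * x)\<close>
  survives and \<open>x\<close> acquires a left factor \<open>g v\<close>.\<close>

lemma hyperbolic_split: "B f v = 1 \<Longrightarrow> I * x = x \<Longrightarrow> x = sR (1/2) (g f * (g v * x) + g v * (g f * x))"
  using clifford[of f v] two by (simp add: distrib_right[symmetric] mult.assoc[symmetric])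

lemma hyperbolic_split_right: "B f v = 1 \<Longrightarrow> x * I = x \<Longrightarrow> x = sR (1/2) (x * g f * g v + x * g v * g f)"
  using clifford[of f v] two by (simp add: distrib_left[symmetric] mult.assoc)

text \<open>Choose \<open>f\<close> dual to \<open>v\<close> and orthogonal to \<open>vs\<close>.
  Since \<open>g f\<close> passes through \<open>P vs\<close> up to sign, both halves of the split
  of \<open>P vs\<close> contain \<open>g v * P vs\<close>; if that vanished, so would
  \<open>P vs\<close>.\<close>

lemma P_nonzero: "isotropic_set (set vs) \<Longrightarrow> independent_list vs \<Longrightarrow> P vs \<noteq> 0"
proof (induction vs)
  case Nil
  then show ?case by (simp add: I_nonzero)
next
  case (Cons v vs)
  note iso = isotropic_set_Cons[OF Cons.prems(1)]
  show ?case
  proof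
    assume 0: "P (v # vs) = 0"
    obtain f where f: "B f v = 1" "\<And>w. w \<in> set vs \<Longrightarrow> B f w = 0"
      using separate_from_span[of v "set vs"] Cons.prems(2) by auto
    have "g f * P vs = sR ((-1) ^ length vs) (P vs * g f)"
      using P_commute[of vs f] f by (simp add: mult.commute)
    then have "g v * (g f * P vs) = 0" using 0 by (simp flip: mult.assoc)
    then have "P vs = 0" using hyperbolic_split[OF f(1), of "P vs"] 0 by simp
    then show False using Cons iso by simp
  qed
qed

text \<open>With \<open>f\<close> dual to \<open>v\<close> and orthogonal to \<open>vs\<close>, the
  element \<open>g f * x\<close> is still killed by \<open>vs\<close>, so by induction it starts
  with \<open>P vs\<close>; the split then restores \<open>x\<close> as half of
  \<open>g v * (g f * x)\<close>.\<close>

lemma P_left_factor: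
  assumes "isotropic_set (set vs)" "independent_list vs" "I * x = x" "\<And>v. v \<in> set vs \<Longrightarrow> g v * x = 0"
  shows "\<exists>z. x = P vs * z"
  using assms
proof (induction vs arbitrary: x)
  case (Cons v vs)
  obtain f where f: "B f v = 1" "\<And>w. w \<in> set vs \<Longrightarrow> B f w = 0"
    using separate_from_span[of v "set vs"] Cons.prems(2) by auto
  have "g w * (g f * x) = 0" if "w \<in> set vs" for w
    using anticommute_left[of w f x] f(2)[OF that] Cons.prems(4)[of w] that by (simp add: B_sym)
  then obtain z where z: "g f * x = P vs * z"
    using Cons.IH[of "g f * x"] Cons.prems isotropic_set_Cons[of v vs] by auto
  have "x = sR (1/2) (g v * (P vs * z))"
    using hyperbolic_split[OF f(1) Cons.prems(3)] Cons.prems(4)[of v] z by simp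
  then have "x = P (v # vs) * sR (1/2) z" by (simp add: mult.assoc)
  then show ?case by blast
next
  case Nil
  then show ?case by (metis P.simps(1))
qed

lemma P_right_factor:
  assumes "isotropic_set (set vs)" "independent_list vs" "x * I = x" "\<And>v. v \<in> set vs \<Longrightarrow> x * g v = 0"
  shows "\<exists>z. x = z * P vs"
  using assms
proof (induction vs arbitrary: x)
  case (Cons v vs)
  note iso = isotropic_set_Cons[OF Cons.prems(1)]
  obtain f where f: "B f v = 1" "\<And>w. w \<in> set vs \<Longrightarrow> B f w = 0"
    using separate_from_span[of v "set vs"] Cons.prems(2) by auto
  have "(x * g f) * g w = 0" if "w \<in> set vs" for w
    using anticommute[of f w] f(2)[OF that] Cons.prems(4)[of w] that
    by (simp add: mult.assoc) (simp flip: mult.assoc)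
  then obtain z where z: "x * g f = z * P vs"
    using Cons.IH[of "x * g f"] Cons.prems iso by (auto simp: mult.assoc)
  have "x = sR (1/2) (z * P vs * g v)"
    using hyperbolic_split_right[OF f(1) Cons.prems(3)] Cons.prems(4)[of v] z by simp
  also have "z * P vs * g v = sR ((-1) ^ length vs) (z * P (v # vs))"
    using P_commute[of vs v] iso by (simp add: mult.assoc)
  finally have "x = sR (1/2 * (-1) ^ length vs) z * P (v # vs)" by simp
  then show ?case by blast
next
  case Nil
  then show ?case by (metis P.simps(1))
qed

end

section \<open>The Casimir operator and elements of rank one\<close>

locale framed_clifford_rep = clifford_rep sV Basis B sR g I
  for sV :: "'k::field \<Rightarrow> 'v::ab_group_add \<Rightarrow> 'v" and Basis and B
    and sR :: "'k \<Rightarrow> 'r::ring \<Rightarrow> 'r" and g and I +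
  fixes U :: "'v set"
  assumes U_finite: "finite U" and U_nonzero: "u \<in> U \<Longrightarrow> B u u \<noteq> 0"
    and U_orthogonal: "u \<in> U \<Longrightarrow> w \<in> U \<Longrightarrow> u \<noteq> w \<Longrightarrow> B u w = 0"
    and U_span: "V.span U = UNIV"
begin

lemma frame_expand: "(\<Sum>u\<in>U. sV (B v u / B u u) u) = v"
proof -
  let ?w = "(\<Sum>u\<in>U. sV (B v u / B u u) u) - v"
  have "B ?w u = 0" if "u \<in> U" for u
  proof -
    have "(\<Sum>a\<in>U. B v a * B a u / B a a) = (\<Sum>a\<in>U. if a = u then B v u else 0)"
      using U_orthogonal U_nonzero that by (intro sum.cong) auto
    then show ?thesis using U_finite that by simp
  qed
  then have "\<forall>y. B ?w y = 0" using orthogonal_span[of U ?w] U_span by blast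
  then have "?w = 0" using nondegenerate unfolding nondegenerate_form_def by blast
  then show ?thesis by simp
qed

lemma g_frame_expand: "(\<Sum>u\<in>U. sR (B v u / B u u) (g u)) = g v"
  using frame_expand[of v] g_simps(6)[of "\<lambda>u. sV (B v u / B u u) u" U] by (simp add: g_simps)

text \<open>The Casimir operator converts left into right multiplication: moving \<open>g v\<close>
  past each \<open>g u\<close> leaves scalar terms \<open>B v u\<close>, which the frame expansion
  reassembles to \<open>g v\<close> on the right.\<close>

lemma casimir_left:
  assumes "I * x = x"
  shows "casimir U (g v * x) = sR 2 (x * g v) - g v * casimir U x"
proof -
  have "sR (1 / B u u) (g u * (g v * x) * g u) = sR 2 (x * sR (B v u / B u u) (g u)) - g v * sR (1 / B u u) (g u * x * g u)" for u
  proof -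
    have "g u * (g v * x) * g u = (g u * g v) * x * g u" by (simp add: mult.assoc)
    also have "g u * g v = sR (2 * B u v) I - g v * g u" by (rule clifford_swap)
    also have "\<dots> * x * g u = sR (2 * B v u) (x * g u) - g v * (g u * x * g u)"
      using assms by (simp add: left_diff_distrib mult.assoc[symmetric] B_sym[of u v])
    finally show ?thesis by (simp add: R.scale_right_diff_distrib)
  qed
  then have "casimir U (g v * x) = (\<Sum>u\<in>U. sR 2 (x * sR (B v u / B u u) (g u)) - g v * sR (1 / B u u) (g u * x * g u))"
    by (simp only: casimir_def)
  also have "\<dots> = sR 2 (x * (\<Sum>u\<in>U. sR (B v u / B u u) (g u))) - g v * casimir U x"
    by (simp only: sum_subtractf casimir_def sum_distrib_left R.scale_sum_right)
  finally show ?thesis by (simp only: g_frame_expand)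
qed

lemma casimir_right:
  assumes "x * I = x"
  shows "casimir U (x * g v) = sR 2 (g v * x) - casimir U x * g v"
proof -
  have "sR (1 / B u u) (g u * (x * g v) * g u) = sR 2 (sR (B v u / B u u) (g u) * x) - sR (1 / B u u) (g u * x * g u) * g v" for u
  proof -
    have "g u * (x * g v) * g u = g u * x * (g v * g u)" by (simp add: mult.assoc)
    also have "g v * g u = sR (2 * B v u) I - g u * g v" by (rule clifford_swap)
    also have "g u * x * \<dots> = sR (2 * B v u) (g u * x) - g u * x * g u * g v"
      using assms by (simp add: right_diff_distrib mult.assoc)
    finally show ?thesis by (simp add: R.scale_right_diff_distrib)
  qed
  then have "casimir U (x * g v) = (\<Sum>u\<in>U. sR 2 (sR (B v u / B u u) (g u) * x) - sR (1 / B u u) (g u * x * g u) * g v)"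
    by (simp only: casimir_def)
  also have "\<dots> = sR 2 ((\<Sum>u\<in>U. sR (B v u / B u u) (g u)) * x) - casimir U x * g v"
    by (simp only: sum_subtractf casimir_def sum_distrib_right R.scale_sum_right)
  finally show ?thesis by (simp only: g_frame_expand)
qed

lemma casimir_add: "casimir U (x + y) = casimir U x + casimir U y"
  by (simp add: casimir_def distrib_left distrib_right R.scale_right_distrib sum.distrib)

lemma casimir_scale: "casimir U (sR c x) = sR c (casimir U x)"
  by (simp add: casimir_def R.scale_sum_right mult.commute)

text \<open>\<open>casimir_left\<close> and \<open>casimir_right\<close> mix the two summands of
  \<open>Q (v # vs)\<close>; the sign in the graded commutator is the one for which both summands
  receive the same new eigenvalue. The start is \<open>casimir U I\<close>, where each frame vector
  contributes one \<open>I\<close>.\<close>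

lemma casimir_Q: "casimir U (Q vs) = sR ((-1) ^ length vs * (of_nat (card U) - 2 * of_nat (length vs))) (Q vs)"
proof (induction vs)
  case Nil
  have "casimir U I = (\<Sum>u\<in>U. I)"
    unfolding casimir_def using U_nonzero by (intro sum.cong) (simp_all add: g_square)
  also have "\<dots> = sR (\<Sum>u\<in>U. 1) I" by (simp only: R.scale_sum_left R.scale_one)
  finally show ?case by simp
next
  case (Cons v vs)
  let ?n = "of_nat (card U) :: 'k" and ?k = "of_nat (length vs) :: 'k" and ?s = "(-1) ^ length vs :: 'k"
  have s: "?s * (?s * c) = c" for c by (simp flip: mult.assoc)
  have "casimir U (Q (v # vs)) = sR 2 (Q vs * g v) - g v * casimir U (Q vs)
    + sR ?s (sR 2 (g v * Q vs) - casimir U (Q vs) * g v)"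
    by (simp add: casimir_add casimir_scale casimir_left casimir_right)
  also have "\<dots> = (sR (?s * 2) (g v * Q vs) - sR (?s * (?n - 2 * ?k)) (g v * Q vs))
     + (sR 2 (Q vs * g v) - sR (?n - 2 * ?k) (Q vs * g v))"
    by (simp add: Cons R.scale_right_diff_distrib s)
  also have "\<dots> = sR (?s * 2 - ?s * (?n - 2 * ?k)) (g v * Q vs) + sR (2 - (?n - 2 * ?k)) (Q vs * g v)"
    by (simp only: R.scale_left_diff_distrib)
  also have "?s * 2 - ?s * (?n - 2 * ?k) = - ?s * (?n - 2 * (?k + 1))" by (simp add: algebra_simps)
  also have "2 - (?n - 2 * ?k) = - ?s * (?n - 2 * (?k + 1)) * ?s"
    by (simp add: algebra_simps s)
  finally show ?case by (simp add: R.scale_right_distrib add.commute)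
qed

text \<open>If \<open>g v * x = 0\<close>, then in \<open>casimir_left\<close> every term except
  \<open>sR 2 (x * g v)\<close> vanishes, since \<open>casimir U x\<close> is a multiple of
  \<open>x\<close>; the converse uses \<open>casimir_right\<close>.\<close>

lemma annihilators_agree:
  assumes "casimir U x = sR c x" "I * x = x" "x * I = x"
  shows "g v * x = 0 \<longleftrightarrow> x * g v = 0"
proof
  assume 0: "g v * x = 0"
  have "sR 2 (x * g v) = casimir U (g v * x) + g v * casimir U x"
    using casimir_left[OF assms(2)] by simp
  also have "\<dots> = 0" by (simp add: 0 assms) (simp add: casimir_def)
  finally show "x * g v = 0" using two by simp
next
  assume 0: "x * g v = 0"
  have "sR 2 (g v * x) = casimir U (x * g v) + casimir U x * g v"
    using casimir_right[OF assms(3)] by simp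
  also have "\<dots> = 0" by (simp add: 0 assms) (simp add: casimir_def)
  finally show "g v * x = 0" using two by simp
qed

text \<open>\<open>rank_one\<close> says without coordinates that \<open>x\<close> has rank at most
  one. It defines a functional \<open>l\<close> with \<open>x * y * x = sR (l y) x\<close>, and
  primeness of the ring allows \<open>x\<close> to be cancelled on the right.\<close>

lemma annihilator_maximal_isotropic:
  assumes x: "casimir U x = sR c x" "I * x = x" "x * I = x" "x \<noteq> 0"
    and rank_one: "\<And>y. \<exists>k. x * y * x = sR k x"
  shows "maximal_isotropic_subspace sV B {v. g v * x = 0}" (is "maximal_isotropic_subspace sV B ?N")
proof -
  obtain l where l: "\<And>y. x * y * x = sR (l y) x" using rank_one by metis
  have key: "x * g v = 0" if v: "B v v = 0" "\<And>w. w \<in> ?N \<Longrightarrow> B v w = 0" for v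
  proof -
    have kills: "x * g v * y * x = 0" if y: "x * y * x = 0" for y
    proof -
      \<comment> \<open>\<open>w\<close> is chosen so that
        \<open>g w * x = casimir U x * y * x\<close>, which vanishes by the eigenvalue equation.
        Thus \<open>w\<close> lies in the annihilator, and the frame expansion of \<open>g v\<close>
        turns \<open>B v w = 0\<close> into \<open>x * g v * y * x = 0\<close>.\<close>
      define w where "w = (\<Sum>u\<in>U. sV (l (g u * y) / B u u) u)"
      have "g w * x = (\<Sum>u\<in>U. sR (1 / B u u) (g u * x * g u)) * y * x"
      proof -
        have "sR (l (g u * y) / B u u) (g u * x) = sR (1 / B u u) (g u * x * g u) * y * x" for u
        proof -
          have "sR (l (g u * y) / B u u) (g u * x) = sR (1 / B u u) (g u * sR (l (g u * y)) x)" by simp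
          also have "\<dots> = sR (1 / B u u) (g u * (x * (g u * y) * x))" by (simp only: l)
          finally show ?thesis by (simp add: mult.assoc)
        qed
        then show ?thesis by (simp add: w_def g_simps sum_distrib_right)
      qed
      also have "\<dots> = casimir U x * y * x" by (simp add: casimir_def)
      also have "\<dots> = 0" using y by (simp add: x)
      finally have "B v w = 0" using v(2) by simp
      then have 0: "(\<Sum>u\<in>U. l (g u * y) / B u u * B v u) = 0" by (simp add: w_def)
      have "x * g v * y * x = x * (\<Sum>u\<in>U. sR (B v u / B u u) (g u)) * y * x"
        by (simp only: g_frame_expand)
      also have "\<dots> = (\<Sum>u\<in>U. sR (B v u / B u u) (x * (g u * y) * x))"
        by (simp add: sum_distrib_left sum_distrib_right mult.assoc)
      also have "\<dots> = sR (\<Sum>u\<in>U. l (g u * y) / B u u * B v u) x"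
        by (simp only: l R.scale_scale R.scale_sum_left) (simp add: mult.commute)
      finally show ?thesis using 0 by simp
    qed
    obtain y where "x * y * x \<noteq> 0" using prime[of x x] x(4) by blast
    then obtain k where k: "x * y * x = sR k x" "k \<noteq> 0" using l by force
    \<comment> \<open>With this normalisation \<open>y - sR (l y) y0\<close> is sent to zero between
      two copies of \<open>x\<close>, so \<open>kills\<close> applies to it. This shows that
      \<open>x * g v\<close> and \<open>sR m x\<close> agree after multiplication by any
      \<open>y * x\<close>.\<close>
    define y0 where "y0 = sR (1 / k) y"
    have y0: "x * y0 * x = x" using k by (simp add: y0_def)
    define m where "m = l (g v * y0)"
    have "(x * g v - sR m x) * y * x = 0" for y
    proof -
      have "x * (y - sR (l y) y0) * x = 0" by (simp add: right_diff_distrib left_diff_distrib y0) (simp add: l)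
      then have "x * g v * (y - sR (l y) y0) * x = 0" by (rule kills)
      then have "x * g v * y * x = sR (l y) (x * (g v * y0) * x)"
        by (simp add: right_diff_distrib left_diff_distrib mult.assoc)
      also have "\<dots> = sR (l y) (sR m x)" by (simp only: l m_def)
      also have "\<dots> = sR m (x * y * x)" by (simp add: l mult.commute)
      finally show ?thesis by (simp add: left_diff_distrib)
    qed
    then have xv: "x * g v = sR m x" using prime[of "x * g v - sR m x" x] x(4) by auto
    \<comment> \<open>Right multiplication by \<open>g v\<close> acts on \<open>x\<close> as the
      scalar \<open>m\<close>; its square is \<open>B v v = 0\<close>.\<close>
    have "0 = x * (g v * g v)" using v(1) by (simp add: g_square)
    also have "\<dots> = sR (m * m) x" by (simp add: xv flip: mult.assoc)
    finally have "m = 0" using x(4) by simp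
    then show ?thesis using xv by simp
  qed
  have iso: "B v w = 0" if "v \<in> ?N" "w \<in> ?N" for v w
  proof -
    have "sR (2 * B v w) x = (g v * g w + g w * g v) * x" using x by (simp add: clifford)
    also have "\<dots> = 0" using that by (simp add: distrib_right mult.assoc)
    finally show ?thesis using x(4) two by simp
  qed
  show ?thesis unfolding maximal_isotropic_subspace_def
  proof (intro conjI allI impI)
    show "isotropic_subspace sV B ?N"
      using iso subspace_left_annihilator by (auto simp: isotropic_subspace_def)
  next
    fix M assume M: "isotropic_subspace sV B M" "?N \<subseteq> M"
    have "v \<in> ?N" if "v \<in> M" for v
    proof -
      have "x * g v = 0" using M that by (intro key) (auto simp: isotropic_subspace_def)
      then show ?thesis using annihilators_agree[OF x(1-3)] by simp
    qed
    then show "M = ?N" using M by auto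
  qed
qed

text \<open>\<open>x\<close> factors both as \<open>P vs * z\<close> and as
  \<open>z' * P vs\<close>. Inserting \<open>P vs = P vs * y * P vs\<close> places \<open>x\<close>
  between two copies of \<open>P vs\<close>, and rank one of \<open>P vs\<close> makes it a
  multiple.\<close>

lemma proportional_to_P:
  assumes x: "casimir U x = sR c x" "I * x = x" "x * I = x"
    and vs: "isotropic_set (set vs)" "independent_list vs" "\<And>v. v \<in> set vs \<Longrightarrow> g v * x = 0"
    and rank_one: "\<And>y. \<exists>k. P vs * y * P vs = sR k (P vs)"
  shows "\<exists>k. x = sR k (P vs)"
proof -
  obtain z where z: "x = P vs * z" using P_left_factor[OF vs(1,2) x(2) vs(3)] by blast
  have f: "\<exists>z'. x = z' * P vs"
    using vs(3) annihilators_agree[OF x] by (intro P_right_factor[OF vs(1,2) x(3)]) auto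
  then obtain z' where z': "x = z' * P vs" by blast
  obtain y where y: "P vs = P vs * (y * P vs)"
  proof -
    have "P vs \<noteq> 0" using P_nonzero vs by simp
    then obtain y where "P vs * y * P vs \<noteq> 0" using prime[of "P vs" "P vs"] by blast
    then obtain k where k: "P vs * y * P vs = sR k (P vs)" "k \<noteq> 0" using rank_one by force
    have "P vs = P vs * (sR (1/k) y * P vs)" using k by (simp flip: mult.assoc)
    then show ?thesis using that by blast
  qed
  have "x = z' * P vs * (y * P vs)" using y z' by (simp add: mult.assoc)
  also have "\<dots> = P vs * z * (y * P vs)" using z z' by simp
  also have "\<dots> = P vs * (z * y) * P vs" by (simp add: mult.assoc)
  finally show ?thesis using rank_one by metis
qed

end

section \<open>The injective map \<open>rho\<close> from the exterior power\<close>

locale exterior_rep = framed_clifford_rep sV Basis B sR g I U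
  for sV :: "'k::field \<Rightarrow> 'v::ab_group_add \<Rightarrow> 'v" and Basis and B
    and sR :: "'k \<Rightarrow> 'r::ring \<Rightarrow> 'r" and g and I and U +
  fixes sW :: "'k \<Rightarrow> 'w::ab_group_add \<Rightarrow> 'w" and p :: nat and wedge :: "'v list \<Rightarrow> 'w"
  assumes exterior: "exterior_power sV sW p wedge"
begin

sublocale W: vector_space sW
  using exterior by (simp add: exterior_power_def)

lemma wedge_linear: "length vs = p \<Longrightarrow> i < p \<Longrightarrow> Vector_Spaces.linear sV sW (\<lambda>x. wedge (vs[i := x]))"
  using exterior by (simp add: exterior_power_def alternating_multilinear_def)

lemma wedge_eq_0: "length vs = p \<Longrightarrow> i < j \<Longrightarrow> j < p \<Longrightarrow> vs ! i = vs ! j \<Longrightarrow> wedge vs = 0"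
  using exterior by (simp add: exterior_power_def alternating_multilinear_def)

lemma wedge_not_distinct: "length vs = p \<Longrightarrow> \<not> distinct vs \<Longrightarrow> wedge vs = 0"
  by (metis distinct_conv_nth nat_neq_iff wedge_eq_0)

definition rho :: "'w \<Rightarrow> 'r" where
  "rho = (SOME r. Vector_Spaces.linear sW sR r \<and> (\<forall>vs. length vs = p \<longrightarrow> r (wedge vs) = Q vs))"

lemma rho_linear: "Vector_Spaces.linear sW sR rho"
  and rho_wedge: "length vs = p \<Longrightarrow> rho (wedge vs) = Q vs"
proof -
  have "\<exists>r. Vector_Spaces.linear sW sR r \<and> (\<forall>vs. length vs = p \<longrightarrow> r (wedge vs) = Q vs)"
    using exterior_power_universal[OF exterior R.vector_space_axioms Q_alternating] by blast
  from someI_ex[OF this] show "Vector_Spaces.linear sW sR rho" "length vs = p \<Longrightarrow> rho (wedge vs) = Q vs"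
    unfolding rho_def[symmetric] by blast+
qed

sublocale rho: Vector_Spaces.linear sW sR rho
  by (rule rho_linear)

lemma exterior_induct [consumes 0, case_names subspace wedge]:
  assumes "W.subspace {w. A w}" and "\<And>vs. length vs = p \<Longrightarrow> A (wedge vs)"
  shows "A w"
  using W.span_minimal[OF _ assms(1), of "wedge ` {vs. length vs = p}"] assms(2)
    exterior_power_span[OF exterior] by auto

lemma I_rho [simp]: "I * rho w = rho w"
  by (induction w rule: exterior_induct)
    (auto simp: W.subspace_def rho.add rho.scale rho_wedge distrib_left)

lemma rho_I [simp]: "rho w * I = rho w"
  by (induction w rule: exterior_induct)
    (auto simp: W.subspace_def rho.add rho.scale rho_wedge distrib_right)

lemma casimir_rho: "casimir U (rho w) = sR ((-1) ^ p * (of_nat (card U) - 2 * of_nat p)) (rho w)"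
proof (induction w rule: exterior_induct)
  case subspace
  have "casimir U 0 = 0" by (simp add: casimir_def)
  then show ?case
    by (auto simp: W.subspace_def rho.add rho.scale casimir_add casimir_scale R.scale_right_distrib mult.commute)
next
  case (wedge vs)
  then show ?case using casimir_Q[of vs] by (simp add: rho_wedge)
qed

lemma wedge_swap:
  assumes "length (pre @ x # y # post) = p"
  shows "wedge (pre @ x # y # post) = - wedge (pre @ y # x # post)"
proof -
  let ?n = "length pre"
  have add1: "wedge (pre @ (a + b) # c # post) = wedge (pre @ a # c # post) + wedge (pre @ b # c # post)" for a b c
  proof -
    interpret l: Vector_Spaces.linear sV sW "\<lambda>x. wedge ((pre @ a # c # post)[?n := x])"
      using assms by (intro wedge_linear) auto
    show ?thesis using l.add[of a b] by simp
  qed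
  have add2: "wedge (pre @ c # (a + b) # post) = wedge (pre @ c # a # post) + wedge (pre @ c # b # post)" for a b c
  proof -
    interpret l: Vector_Spaces.linear sV sW "\<lambda>x. wedge ((pre @ c # a # post)[Suc ?n := x])"
      using assms by (intro wedge_linear) auto
    show ?thesis using l.add[of a b] by (simp add: list_update_append)
  qed
  have same: "wedge (pre @ a # a # post) = 0" for a
    using assms by (intro wedge_not_distinct) auto
  have "wedge (pre @ x # y # post) + wedge (pre @ y # x # post) = 0"
    using same[of "x + y"] unfolding add1 unfolding add2 unfolding same by simp
  then show ?thesis by (simp add: eq_neg_iff_add_eq_0)
qed

lemma wedge_move_front:
  "length (pre @ as @ x # post) = p \<Longrightarrow> \<exists>c. wedge (pre @ as @ x # post) = sW c (wedge (pre @ x # as @ post))"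
proof (induction as arbitrary: pre)
  case Nil
  then show ?case by (auto intro!: exI[of _ 1])
next
  case (Cons a as)
  obtain c where "wedge ((pre @ [a]) @ as @ x # post) = sW c (wedge ((pre @ [a]) @ x # as @ post))"
    using Cons.IH[of "pre @ [a]"] Cons.prems by auto
  then have "wedge (pre @ (a # as) @ x # post) = sW (- c) (wedge (pre @ x # a # as @ post))"
    using wedge_swap[of pre a x "as @ post"] Cons.prems by simp
  then show ?case by (intro exI[of _ "- c"]) simp
qed

text \<open>Only proportionality is recorded: it shows that all wedges of frame vectors with the
  same underlying set lie on one line.\<close>

lemma wedge_permute:
  "mset l = mset m \<Longrightarrow> length (pre @ m) = p \<Longrightarrow> \<exists>c. wedge (pre @ m) = sW c (wedge (pre @ l))"
proof (induction l arbitrary: pre m)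
  case Nil
  then show ?case by (auto intro!: exI[of _ 1])
next
  case (Cons x l)
  have "x \<in> set m" using Cons.prems(1) by (metis list.set_intros(1) set_mset_mset)
  then obtain as post where m: "m = as @ x # post" by (meson split_list)
  have "mset l = mset (as @ post)" using Cons.prems(1) m by simp
  then obtain c where c: "wedge (pre @ x # as @ post) = sW c (wedge (pre @ x # l))"
    using Cons.IH[of "as @ post" "pre @ [x]"] Cons.prems m by auto
  obtain d where "wedge (pre @ m) = sW d (wedge (pre @ x # as @ post))"
    using wedge_move_front[of pre as x post] Cons.prems m by auto
  then have "wedge (pre @ m) = sW (d * c) (wedge (pre @ x # l))" using c by simp
  then show ?case by blast
qed

definition frame_wedges :: "'v set set \<Rightarrow> 'w set" where
  "frame_wedges F = wedge ` {l. length l = p \<and> distinct l \<and> set l \<in> F}"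

lemma frame_wedges_span: "W.span (frame_wedges (Pow U)) = UNIV"
proof -
  let ?S = "W.span (frame_wedges (Pow U))"
  \<comment> \<open>Arbitrary entries are allowed only in the first \<open>k\<close> places. The
    induction step expands the last of them, at index \<open>k\<close>, in the frame;
    \<open>k = p\<close> is the general case.\<close>
  have "wedge vs \<in> ?S" if "length vs = p" "\<And>i. k \<le> i \<Longrightarrow> i < p \<Longrightarrow> vs ! i \<in> U" "k \<le> p" for k vs
    using that
  proof (induction k arbitrary: vs)
    case 0
    then have "set vs \<subseteq> U" by (auto simp: in_set_conv_nth)
    show ?case
    proof (cases "distinct vs")
      case True
      then show ?thesis using 0 \<open>set vs \<subseteq> U\<close> by (intro W.span_base) (auto simp: frame_wedges_def)
    next
      case False
      then show ?thesis using 0 by (simp add: wedge_not_distinct W.span_zero)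
    qed
  next
    case (Suc k)
    interpret l: Vector_Spaces.linear sV sW "\<lambda>x. wedge (vs[k := x])"
      using Suc.prems by (intro wedge_linear) auto
    have "U \<subseteq> {x. wedge (vs[k := x]) \<in> ?S}"
    proof
      fix u assume "u \<in> U"
      then have "wedge (vs[k := u]) \<in> ?S"
        using Suc.prems by (intro Suc.IH) (auto simp: nth_list_update)
      then show "u \<in> {x. wedge (vs[k := x]) \<in> ?S}" by simp
    qed
    moreover have "V.subspace {x. wedge (vs[k := x]) \<in> ?S}"
      by (auto simp: V.subspace_def l.zero l.add l.scale W.span_zero W.span_add W.span_scale)
    ultimately have "V.span U \<subseteq> {x. wedge (vs[k := x]) \<in> ?S}" by (rule V.span_minimal)
    then have "wedge (vs[k := vs ! k]) \<in> ?S" using U_span by blast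
    then show ?case by simp
  qed
  note frame = this[of _ p]
  have "w \<in> ?S" for w
    by (rule exterior_induct[of "\<lambda>w. w \<in> ?S"]) (simp_all add: W.subspace_span frame)
  then show ?thesis by auto
qed

lemma frame_orthogonal_list: "distinct l \<Longrightarrow> set l \<subseteq> U \<Longrightarrow> orthogonal_list l"
  by (induction l) (auto intro: U_orthogonal)

lemma frame_P_nonzero: "set l \<subseteq> U \<Longrightarrow> P l \<noteq> 0"
proof (induction l)
  case Nil
  then show ?case by (simp add: I_nonzero)
next
  case (Cons u l)
  then have "g u * (g u * P l) \<noteq> 0" using U_nonzero by (simp add: g_self_left)
  then show ?case by auto
qed

text \<open>Every factor other than \<open>u\<close> changes the sign, while a factor
  \<open>u\<close> commutes with \<open>g u\<close>; this accounts for the extra exponent when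
  \<open>u\<close> occurs.\<close>

lemma frame_P_commute:
  assumes "distinct l" "set l \<subseteq> U" "u \<in> U"
  shows "g u * P l = sR ((-1) ^ (length l + (if u \<in> set l then 1 else 0))) (P l * g u)"
  using assms
proof (induction l)
  case (Cons w l)
  show ?case
  proof (cases "u = w")
    case True
    have "g u * P l = sR ((-1) ^ length l) (P l * g u)" using Cons True by auto
    then have "g u * (g u * P l) = sR ((-1) ^ length l) (g u * (P l * g u))" by simp
    then show ?thesis using True by (simp add: mult.assoc)
  next
    case False
    then have "g u * P (w # l) = - (g w * (g u * P l))"
      using anticommute_left[of u w] U_orthogonal[of u w] Cons.prems by simp
    then show ?thesis using Cons False by (simp add: mult.assoc)
  qed
qed simp

lemma frame_wedges_commute:
  assumes "x \<in> W.span (frame_wedges F)" "F \<subseteq> Pow U" "u \<in> U" "\<And>A. A \<in> F \<Longrightarrow> u \<in> A \<longleftrightarrow> b"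
  shows "g u * rho x = sR ((-1) ^ (p + (if b then 1 else 0))) (rho x * g u)"
proof -
  let ?c = "(-1) ^ (p + (if b then 1 else 0)) :: 'k"
  have "frame_wedges F \<subseteq> {x. g u * rho x = sR ?c (rho x * g u)}"
  proof
    fix x assume "x \<in> frame_wedges F"
    then obtain l where l: "x = wedge l" "length l = p" "distinct l" "set l \<in> F"
      by (auto simp: frame_wedges_def)
    then have "rho x = sR (2 ^ p) (P l)"
      using assms(2) Q_orthogonal[OF frame_orthogonal_list[of l]] by (auto simp: rho_wedge)
    then show "x \<in> {x. g u * rho x = sR ?c (rho x * g u)}"
      using frame_P_commute[of l u] l assms by (auto simp: mult.commute)
  qed
  moreover have "W.subspace {x. g u * rho x = sR ?c (rho x * g u)}"
    by (auto simp: W.subspace_def rho.zero rho.add rho.scale distrib_left distrib_right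
        R.scale_right_distrib mult.commute simp del: power_Suc)
  ultimately show ?thesis using W.span_minimal assms(1) by blast
qed

text \<open>Conjugation by a frame vector \<open>u\<close> acts on the images of frame wedges by signs that tell whether \<open>u\<close> occurs.\<close>

lemma rho_injective_frame:
  assumes "finite F" "F \<subseteq> Pow U" "x \<in> W.span (frame_wedges F)" "rho x = 0"
  shows "x = 0"
  using assms
proof (induction F arbitrary: x rule: finite_psubset_induct)
  case (psubset F)
  show ?case
  \<comment> \<open>If some \<open>u\<close> separates two members of \<open>F\<close>, split
    \<open>F\<close> by membership of \<open>u\<close>. The two parts of \<open>rho x\<close> sum to
    zero but obey opposite commutation signs with \<open>g u\<close>, so each is killed by the
    invertible \<open>g u\<close> and induction applies to both.\<close>
  proof (cases "\<exists>A\<in>F. \<exists>A'\<in>F. \<exists>u. u \<in> A \<and> u \<notin> A'")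
    case True
    then obtain A A' u where u: "A \<in> F" "A' \<in> F" "u \<in> A" "u \<notin> A'" by blast
    then have uU: "u \<in> U" using psubset.prems by auto
    define F1 F2 where "F1 = {X\<in>F. u \<in> X}" and "F2 = {X\<in>F. u \<notin> X}"
    have sub: "F1 \<subset> F" "F2 \<subset> F" using u by (auto simp: F1_def F2_def)
    then have subU: "F1 \<subseteq> Pow U" "F2 \<subseteq> Pow U" using psubset.prems(1) by auto
    have "frame_wedges F = frame_wedges F1 \<union> frame_wedges F2"
      unfolding frame_wedges_def F1_def F2_def by blast
    then obtain x1 x2 where x: "x = x1 + x2" "x1 \<in> W.span (frame_wedges F1)" "x2 \<in> W.span (frame_wedges F2)"
      using psubset.prems(2) W.span_Un by auto
    have c1: "g u * rho x1 = sR (- ((-1) ^ p)) (rho x1 * g u)"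
      using frame_wedges_commute[OF x(2) subU(1) uU, of True] by (simp add: F1_def)
    have c2: "g u * rho x2 = sR ((-1) ^ p) (rho x2 * g u)"
      using frame_wedges_commute[OF x(3) subU(2) uU, of False] by (simp add: F2_def)
    have sum: "rho x1 + rho x2 = 0" using psubset.prems x by (simp add: rho.add)
    then have r: "rho x2 = - rho x1" by (simp add: eq_neg_iff_add_eq_0 add.commute)
    have "sR ((-1) ^ p) (rho x1 * g u) = - sR ((-1) ^ p) (rho x1 * g u)"
      using c1 c2 unfolding r by simp
    then have "sR ((-1) ^ p) (rho x1 * g u) + sR ((-1) ^ p) (rho x1 * g u) = 0"
      by (simp only: eq_neg_iff_add_eq_0)
    then have "rho x1 * g u = 0" using two unfolding scale_two by simp
    then have "rho x1 * (g u * g u) = 0" by (simp flip: mult.assoc)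
    then have r1: "rho x1 = 0" using U_nonzero[OF uU] by (simp add: g_square)
    then have "x1 = 0" "x2 = 0"
      using psubset.IH[OF sub(1) subU(1) x(2)] psubset.IH[OF sub(2) subU(2) x(3)] r by auto
    then show ?thesis using x by simp
  next
    case False
    \<comment> \<open>Now \<open>F\<close> has at most one member, so the span is at most a line,
      generated by a wedge whose image is a nonzero multiple of some \<open>P l\<close>.\<close>
    then have eq: "A = A'" if "A \<in> F" "A' \<in> F" for A A' using that by blast
    show ?thesis
    proof (cases "frame_wedges F = {}")
      case True
      then show ?thesis using psubset.prems by simp
    next
      case False
      then obtain l where l: "length l = p" "distinct l" "set l \<in> F" by (auto simp: frame_wedges_def)
      have "frame_wedges F \<subseteq> W.span {wedge l}"
      proof
        fix y assume "y \<in> frame_wedges F"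
        then obtain m where m: "y = wedge m" "length m = p" "distinct m" "set m \<in> F"
          by (auto simp: frame_wedges_def)
        then have "mset l = mset m" using l eq set_eq_iff_mset_eq_distinct by metis
        then obtain c where "y = sW c (wedge l)" using wedge_permute[of l m "[]"] m by auto
        then show "y \<in> W.span {wedge l}" by (auto intro: W.span_scale W.span_base)
      qed
      then have "x \<in> W.span {wedge l}" using psubset.prems(2) W.span_minimal W.subspace_span by blast
      then obtain c where c: "x = sW c (wedge l)" by (auto simp: W.span_singleton)
      have lU: "set l \<subseteq> U" using l psubset.prems by auto
      have "rho x = sR (c * 2 ^ p) (P l)"
        using c l lU Q_orthogonal[OF frame_orthogonal_list[of l]] by (simp add: rho.scale rho_wedge)
      then have "c = 0" using psubset.prems frame_P_nonzero[OF lU] two by simp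
      then show ?thesis using c by simp
    qed
  qed
qed

lemma rho_injective: "rho x = 0 \<Longrightarrow> x = 0"
  using rho_injective_frame[of "Pow U" x] frame_wedges_span U_finite by auto

lemma rho_isotropic:
  "isotropic_set (set vs) \<Longrightarrow> length vs = p \<Longrightarrow> rho (wedge vs) = sR (2 ^ p) (P vs)"
  using Q_orthogonal[OF isotropic_set_orthogonal_list[of vs]] by (simp add: rho_wedge)

lemma wedge_isotropic_nonzero_iff:
  assumes "isotropic_set (set vs)" "length vs = p"
  shows "wedge vs \<noteq> 0 \<longleftrightarrow> independent_list vs"
proof -
  have "wedge vs \<noteq> 0 \<longleftrightarrow> P vs \<noteq> 0"
    using rho_injective[of "wedge vs"] rho_isotropic[OF assms] two by (auto simp: rho.zero)
  then show ?thesis using P_nonzero P_dependent assms(1) by blast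
qed

end

section \<open>Operators on Fock space\<close>

text \<open>Linear operators are made a type of their own so that composition can be the product of
  a \<open>ring\<close> instance and the Clifford locales apply.\<close>

typedef (overloaded) 'k op =
  "{T :: (nat set \<Rightarrow> 'k::field) \<Rightarrow> nat set \<Rightarrow> 'k.
     (\<forall>f h. T (f + h) = T f + T h) \<and> (\<forall>c f. T (\<lambda>\<alpha>. c * f \<alpha>) = (\<lambda>\<alpha>. c * T f \<alpha>))}"
  morphisms app Abs_op
  by (intro exI[of _ "\<lambda>f. f"]) simp

setup_lifting type_definition_op

instantiation op :: (field) ring
begin

lift_definition zero_op :: "'a op" is "\<lambda>f \<alpha>. 0"
  by (auto simp: fun_eq_iff)
lift_definition plus_op :: "'a op \<Rightarrow> 'a op \<Rightarrow> 'a op" is "\<lambda>S T f \<alpha>. S f \<alpha> + T f \<alpha>"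
  by (auto simp: fun_eq_iff algebra_simps)
lift_definition minus_op :: "'a op \<Rightarrow> 'a op \<Rightarrow> 'a op" is "\<lambda>S T f \<alpha>. S f \<alpha> - T f \<alpha>"
  by (auto simp: fun_eq_iff algebra_simps)
lift_definition uminus_op :: "'a op \<Rightarrow> 'a op" is "\<lambda>T f \<alpha>. - T f \<alpha>"
  by (auto simp: fun_eq_iff algebra_simps)
lift_definition times_op :: "'a op \<Rightarrow> 'a op \<Rightarrow> 'a op" is "\<lambda>S T f. S (T f)"
  by auto

instance
proof
  fix a b c :: "'a op"
  show "a * b * c = a * (b * c)" by transfer simp
  show "a + b + c = a + (b + c)" by transfer (simp add: algebra_simps)
  show "a + b = b + a" by transfer (simp add: algebra_simps)
  show "0 + a = a" by transfer simp
  show "- a + a = 0" by transfer simp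
  show "a - b = a + - b" by transfer simp
  show "(a + b) * c = a * c + b * c" by transfer simp
  show "a * (b + c) = a * b + a * c" by transfer (auto simp: fun_eq_iff plus_fun_def)
qed

end

lift_definition scale_op :: "'k::field \<Rightarrow> 'k op \<Rightarrow> 'k op" is "\<lambda>c T f \<alpha>. c * T f \<alpha>"
  by (auto simp: fun_eq_iff algebra_simps)

lift_definition proj_op :: "nat set set \<Rightarrow> 'k::field op" is "\<lambda>D f \<alpha>. if \<alpha> \<in> D then f \<alpha> else 0"
  by (auto simp: fun_eq_iff)

lift_definition rank_one_op :: "nat set \<Rightarrow> (nat set \<Rightarrow> 'k) \<Rightarrow> 'k::field op" is "\<lambda>\<gamma> h f \<alpha>. f \<gamma> * h \<alpha>"
  by (auto simp: fun_eq_iff algebra_simps)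

lemma op_eqI: "(\<And>f \<alpha>. app S f \<alpha> = app T f \<alpha>) \<Longrightarrow> S = T"
  by transfer auto

lemma app_simps [simp]:
  "app 0 f \<alpha> = 0" "app (S + T) f \<alpha> = app S f \<alpha> + app T f \<alpha>" "app (S - T) f \<alpha> = app S f \<alpha> - app T f \<alpha>"
  "app (- T) f \<alpha> = - app T f \<alpha>" "app (S * T) f = app S (app T f)" "app (scale_op c T) f \<alpha> = c * app T f \<alpha>"
  "app (proj_op D) f \<alpha> = (if \<alpha> \<in> D then f \<alpha> else 0)" "app (rank_one_op \<gamma> h) f \<alpha> = f \<gamma> * h \<alpha>"
  by (transfer, auto)+

lemma vector_space_scale_op: "vector_space scale_op"
  by unfold_locales (auto intro!: op_eqI simp: algebra_simps)

lemma scale_op_mult: "scale_op c x * y = scale_op c (x * y)" "x * scale_op c y = scale_op c (x * y)"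
  by (transfer; auto)+

abbreviation scale_fun :: "'k::field \<Rightarrow> ('i \<Rightarrow> 'k) \<Rightarrow> 'i \<Rightarrow> 'k" where
  "scale_fun c f \<equiv> \<lambda>\<alpha>. c * f \<alpha>"

lemma vector_space_scale_fun: "vector_space (scale_fun :: 'k::field \<Rightarrow> ('i \<Rightarrow> 'k) \<Rightarrow> _)"
  by unfold_locales (auto simp: fun_eq_iff algebra_simps)

global_interpretation F: vector_space "scale_fun :: 'k::field \<Rightarrow> ('i \<Rightarrow> 'k) \<Rightarrow> _"
  by (rule vector_space_scale_fun)

lemma app_linear: "Vector_Spaces.linear scale_fun scale_fun (app T)"
  unfolding Vector_Spaces.linear_iff using app[of T] by (auto simp: vector_space_scale_fun)

interpretation app: Vector_Spaces.linear scale_fun scale_fun "app T" for T :: "'k::field op"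
  by (rule app_linear)

lemma app_scale: "app T (\<lambda>\<alpha>. c * f \<alpha>) = (\<lambda>\<alpha>. c * app T f \<alpha>)"
  by (rule app.scale)

text \<open>If \<open>z f\<close> has a nonzero coordinate \<open>\<gamma>\<close>, a rank-one
  operator reading off that coordinate sends \<open>z f\<close> to a nonzero multiple of any given
  \<open>h\<close>, so \<open>x\<close> vanishes on \<open>h\<close>.\<close>

lemma op_prime:
  fixes x z :: "'k::field op"
  assumes "\<And>y. x * y * z = 0"
  shows "x = 0 \<or> z = 0"
proof (rule disjCI)
  assume "z \<noteq> 0"
  then obtain f \<gamma> where f: "app z f \<gamma> \<noteq> 0" by (metis app_simps(1) op_eqI)
  show "x = 0"
  proof (rule op_eqI)
    fix h \<alpha>
    have eq: "app (rank_one_op \<gamma> h) (app z f) = (\<lambda>\<beta>. app z f \<gamma> * h \<beta>)"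
      by (simp add: fun_eq_iff)
    have "app (x * rank_one_op \<gamma> h * z) f \<alpha> = 0" using assms by simp
    then show "app x h \<alpha> = app 0 h \<alpha>" using f by (simp add: eq app_scale)
  qed
qed

text \<open>Write \<open>x f\<close> as \<open>t f\<close> times \<open>s\<close>. Then
  \<open>x * y * x\<close> sends \<open>f\<close> to \<open>t f * t (y s)\<close> times
  \<open>s\<close>, so the scalar is \<open>t (y s)\<close>.\<close>

lemma rank_one_if_range_line:
  assumes "\<And>f. \<exists>c. app x f = (\<lambda>\<alpha>. c * s \<alpha>)"
  shows "\<exists>k. x * y * x = scale_op k x"
proof -
  obtain t where t: "\<And>f. app x f = (\<lambda>\<alpha>. t f * s \<alpha>)" using assms by metis
  have "x * y * x = scale_op (t (app y s)) x"
  proof (rule op_eqI)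
    fix f \<alpha>
    have "app (x * y * x) f = app x (app y (\<lambda>\<alpha>. t f * s \<alpha>))" by (simp add: t[of f])
    also have "\<dots> = (\<lambda>\<alpha>. t f * (t (app y s) * s \<alpha>))" by (simp add: app_scale t[of "app y s"])
    finally show "app (x * y * x) f \<alpha> = app (scale_op (t (app y s)) x) f \<alpha>" by (simp add: t[of f])
  qed
  then show ?thesis by blast
qed

section \<open>Matrix entries and minors\<close>

definition delta :: "nat set \<Rightarrow> nat set \<Rightarrow> 'k::field" where
  "delta \<beta> = (\<lambda>\<alpha>. if \<alpha> = \<beta> then 1 else 0)"

definition entry :: "'k::field op \<Rightarrow> nat set \<Rightarrow> nat set \<Rightarrow> 'k" where
  "entry x \<alpha> \<beta> = app x (delta \<beta>) \<alpha>"

lemma proj_expand: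
  assumes "finite D" shows "app (proj_op D) f = (\<Sum>\<beta>\<in>D. (\<lambda>\<alpha>. f \<beta> * delta \<beta> \<alpha>))"
proof
  fix \<alpha>
  have s: "(\<Sum>\<beta>\<in>D'. (\<lambda>\<alpha>. f \<beta> * delta \<beta> \<alpha>)) \<alpha> = (\<Sum>\<beta>\<in>D'. f \<beta> * delta \<beta> \<alpha>)" for D'
    by (induction D' rule: infinite_finite_induct) auto
  have "(\<Sum>\<beta>\<in>D. f \<beta> * delta \<beta> \<alpha>) = (\<Sum>\<beta>\<in>D. if \<beta> = \<alpha> then f \<alpha> else 0)"
    by (intro sum.cong) (auto simp: delta_def)
  then show "app (proj_op D) f \<alpha> = (\<Sum>\<beta>\<in>D. (\<lambda>\<alpha>. f \<beta> * delta \<beta> \<alpha>)) \<alpha>"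
    using assms by (simp add: s)
qed

lemma sum_fun_apply: "(\<Sum>\<beta>\<in>D. h \<beta>) \<alpha> = (\<Sum>\<beta>\<in>D. h \<beta> \<alpha>)"
  for h :: "'i \<Rightarrow> 'j \<Rightarrow> 'k::field"
  by (induction D rule: infinite_finite_induct) auto

lemma app_entries:
  assumes "finite D" "x * proj_op D = x"
  shows "app x f \<alpha> = (\<Sum>\<beta>\<in>D. f \<beta> * entry x \<alpha> \<beta>)"
proof -
  have "app x f = app (x * proj_op D) f" by (simp only: assms)
  also have "\<dots> = (\<Sum>\<beta>\<in>D. (\<lambda>\<alpha>. f \<beta> * app x (delta \<beta>) \<alpha>))"
    by (simp add: proj_expand[OF assms(1)] app.sum app_scale)
  finally show ?thesis by (simp add: sum_fun_apply entry_def)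
qed

lemma entries_0:
  assumes "finite D" "x * proj_op D = x" "proj_op D * x = x"
    and "\<And>\<alpha> \<beta>. \<alpha> \<in> D \<Longrightarrow> \<beta> \<in> D \<Longrightarrow> entry x \<alpha> \<beta> = 0"
  shows "x = 0"
proof (rule op_eqI)
  fix f \<alpha>
  have "app x f \<alpha> = app (proj_op D * x) f \<alpha>" by (simp only: assms(3))
  also have "\<dots> = (if \<alpha> \<in> D then app x f \<alpha> else 0)" by simp
  also have "\<dots> = 0" using assms by (simp add: app_entries[OF assms(1,2)])
  finally show "app x f \<alpha> = app 0 f \<alpha>" by simp
qed

text \<open>A nonzero entry at \<open>\<alpha>0\<close>, \<open>\<beta>0\<close> serves as pivot:
  the minors through it make every column a multiple of column \<open>\<beta>0\<close>, which
  therefore spans the range.\<close>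

lemma rank_one_if_minors_0:
  assumes D: "finite D" "x * proj_op D = x" "proj_op D * x = x"
    and minors: "\<And>\<alpha> \<beta> \<gamma> \<delta>. \<alpha> \<in> D \<Longrightarrow> \<beta> \<in> D \<Longrightarrow> \<gamma> \<in> D \<Longrightarrow> \<delta> \<in> D \<Longrightarrow>
        entry x \<alpha> \<beta> * entry x \<gamma> \<delta> = entry x \<alpha> \<delta> * entry x \<gamma> \<beta>"
  shows "\<exists>k. x * y * x = scale_op k x"
proof (cases "x = 0")
  case True
  then show ?thesis by (auto intro!: op_eqI exI[of _ 0])
next
  case False
  then obtain \<alpha>0 \<beta>0 where ne: "\<alpha>0 \<in> D" "\<beta>0 \<in> D" "entry x \<alpha>0 \<beta>0 \<noteq> 0"
    using entries_0[OF D] by blast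
  show ?thesis
  proof (rule rank_one_if_range_line)
    fix f
    have "app x f \<alpha> = app x f \<alpha>0 / entry x \<alpha>0 \<beta>0 * app x (delta \<beta>0) \<alpha>" for \<alpha>
    proof (cases "\<alpha> \<in> D")
      case True
      have "app x f \<alpha> * entry x \<alpha>0 \<beta>0 = (\<Sum>\<beta>\<in>D. f \<beta> * (entry x \<alpha> \<beta> * entry x \<alpha>0 \<beta>0))"
        by (simp add: app_entries[OF D(1,2), of f] sum_distrib_right mult.assoc)
      also have "\<dots> = (\<Sum>\<beta>\<in>D. f \<beta> * (entry x \<alpha> \<beta>0 * entry x \<alpha>0 \<beta>))"
        using minors True ne by (intro sum.cong) auto
      also have "\<dots> = app x f \<alpha>0 * entry x \<alpha> \<beta>0"
        unfolding app_entries[OF D(1,2), of f] sum_distrib_right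
        by (intro sum.cong refl) (simp only: mult_ac)
      finally show ?thesis using ne by (simp add: entry_def field_simps)
    next
      case False
      have "app x h \<alpha> = app (proj_op D * x) h \<alpha>" for h by (simp only: D)
      then show ?thesis using False by simp
    qed
    then show "\<exists>c. app x f = (\<lambda>\<alpha>. c * app x (delta \<beta>0) \<alpha>)" by blast
  qed
qed

lemma minors_0_if_range_line:
  assumes "\<And>f. \<exists>c. app x f = (\<lambda>\<alpha>. c * s \<alpha>)"
  shows "entry x \<alpha> \<beta> * entry x \<gamma> \<delta> = entry x \<alpha> \<delta> * entry x \<gamma> \<beta>"
proof -
  obtain t where t: "\<And>f. app x f = (\<lambda>\<alpha>. t f * s \<alpha>)" using assms by metis
  show ?thesis by (simp add: entry_def t)
qed

section \<open>Creation and annihilation operators and the spinor representation\<close>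

definition fock_sign :: "nat \<Rightarrow> nat set \<Rightarrow> 'k::field" where
  "fock_sign i \<alpha> = (-1) ^ card {j\<in>\<alpha>. j < i}"

lemma fock_sign_square [simp]: "fock_sign i \<alpha> * fock_sign i \<alpha> = (1::'k::field)"
  "fock_sign i \<alpha> * (fock_sign i \<alpha> * x) = (x::'k::field)"
  by (simp_all add: fock_sign_def flip: mult.assoc)

text \<open>\<open>fock_sign i \<alpha>\<close> is the sign of moving the \<open>i\<close>-th basis
  vector past the smaller ones in the increasing product indexed by \<open>\<alpha>\<close>; a new
  \<open>j\<close> matters only if it is smaller than \<open>i\<close>.\<close>

lemma fock_sign_insert:
  assumes "j \<notin> \<alpha>" "finite \<alpha>"
  shows "fock_sign i (insert j \<alpha>) = (if j < i then - fock_sign i \<alpha> else (fock_sign i \<alpha> :: 'k::field))"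
proof -
  have "{k \<in> insert j \<alpha>. k < i} = (if j < i then insert j {k\<in>\<alpha>. k < i} else {k\<in>\<alpha>. k < i})" by auto
  then show ?thesis using assms by (simp add: fock_sign_def)
qed

lemma fock_sign_remove:
  assumes "j \<in> \<alpha>" "finite \<alpha>"
  shows "fock_sign i (\<alpha> - {j}) = (if j < i then - fock_sign i \<alpha> else (fock_sign i \<alpha> :: 'k::field))"
  using fock_sign_insert[of j "\<alpha> - {j}" i, where ?'k = 'k] assms
  by (cases "j < i") (simp_all add: insert_absorb)

text \<open>A function \<open>f\<close> on sets stands for \<open>\<Sum> f \<alpha> e\<^sub>\<alpha>\<close> in the exterior algebra of a space with basis \<open>e\<^sub>0, e\<^sub>1, \<dots>\<close>; the
  operators below live on the part spanned by the subsets of \<open>{..<p}\<close> and vanish on the rest.\<close>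

lift_definition create :: "nat \<Rightarrow> nat \<Rightarrow> 'k::field op" is
  "\<lambda>p i f \<alpha>. if \<alpha> \<subseteq> {..<p} \<and> i \<in> \<alpha> then fock_sign i \<alpha> * f (\<alpha> - {i}) else 0"
  by (auto simp: fun_eq_iff algebra_simps)

lift_definition annihilate :: "nat \<Rightarrow> nat \<Rightarrow> 'k::field op" is
  "\<lambda>p i f \<alpha>. if \<alpha> \<subseteq> {..<p} \<and> i < p \<and> i \<notin> \<alpha> then fock_sign i \<alpha> * f (insert i \<alpha>) else 0"
  by (auto simp: fun_eq_iff algebra_simps)

lift_definition grading :: "nat \<Rightarrow> 'k::field op" is
  "\<lambda>p f \<alpha>. if \<alpha> \<subseteq> {..<p} then (-1) ^ card \<alpha> * f \<alpha> else 0"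
  by (auto simp: fun_eq_iff algebra_simps)

lemma app_fock [simp]:
  "app (create p i) f \<alpha> = (if \<alpha> \<subseteq> {..<p} \<and> i \<in> \<alpha> then fock_sign i \<alpha> * f (\<alpha> - {i}) else 0)"
  "app (annihilate p i) f \<alpha> = (if \<alpha> \<subseteq> {..<p} \<and> i < p \<and> i \<notin> \<alpha> then fock_sign i \<alpha> * f (insert i \<alpha>) else 0)"
  "app (grading p) f \<alpha> = (if \<alpha> \<subseteq> {..<p} then (-1) ^ card \<alpha> * f \<alpha> else 0)"
  by (transfer, simp)+

lemma finite_subset_lessThan: "\<alpha> \<subseteq> {..<p::nat} \<Longrightarrow> finite \<alpha>"
  using finite_subset by blast

lemma create_create: "create p i * create p j = - (create p j * create p i :: 'k::field op)"
proof (rule op_eqI)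
  fix f and \<alpha> :: "nat set"
  have "\<alpha> - {i} - {j} = \<alpha> - {j} - {i}" by auto
  then show "app (create p i * create p j) f \<alpha> = app (- (create p j * create p i)) f \<alpha>"
    by (cases i j rule: linorder_cases) (auto simp: fock_sign_remove finite_subset_lessThan)
qed

lemma annihilate_annihilate: "annihilate p i * annihilate p j = - (annihilate p j * annihilate p i :: 'k::field op)"
proof (rule op_eqI)
  fix f and \<alpha> :: "nat set"
  show "app (annihilate p i * annihilate p j) f \<alpha> = app (- (annihilate p j * annihilate p i)) f \<alpha>"
    by (cases i j rule: linorder_cases)
      (auto simp: fock_sign_insert finite_subset_lessThan insert_commute[of i j])
qed

lemma create_annihilate:
  assumes "i \<noteq> j"
  shows "create p i * annihilate p j = - (annihilate p j * create p i :: 'k::field op)"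
proof (rule op_eqI)
  fix f and \<alpha> :: "nat set"
  have "insert j \<alpha> - {i} = insert j (\<alpha> - {i})" using assms by auto
  then show "app (create p i * annihilate p j) f \<alpha> = app (- (annihilate p j * create p i)) f \<alpha>"
    using assms by (cases i j rule: linorder_cases)
      (auto simp: fock_sign_insert fock_sign_remove finite_subset_lessThan)
qed

lemma create_annihilate_same:
  assumes "i < p"
  shows "create p i * annihilate p i + annihilate p i * create p i = (proj_op (Pow {..<p}) :: 'k::field op)"
proof (rule op_eqI)
  fix f and \<alpha> :: "nat set"
  show "app (create p i * annihilate p i + annihilate p i * create p i) f \<alpha> = app (proj_op (Pow {..<p})) f \<alpha>"
    using assms by (auto simp: fock_sign_insert fock_sign_remove finite_subset_lessThan insert_absorb)
qed

lemma create_square [simp]: "create p i * create p i = (0 :: 'k::field op)"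
  and annihilate_square [simp]: "annihilate p i * annihilate p i = (0 :: 'k::field op)"
  by (auto intro!: op_eqI)

lemma grading_create: "grading p * create p i = - (create p i * grading p :: 'k::field op)"
proof (rule op_eqI)
  fix f :: "nat set \<Rightarrow> 'k" and \<alpha> :: "nat set"
  have sign: "(-1 :: 'k) ^ card \<alpha> = - ((-1) ^ card (\<alpha> - {i}))" if "i \<in> \<alpha>" "\<alpha> \<subseteq> {..<p}"
  proof -
    have "card \<alpha> = Suc (card (\<alpha> - {i}))" by (rule card.remove[OF finite_subset_lessThan[OF that(2)] that(1)])
    then show ?thesis by (simp only: power_Suc mult_minus1)
  qed
  have swap: "(-1) ^ card \<alpha> * (x * y) = - (x * ((-1) ^ card (\<alpha> - {i}) * y))"
    if "i \<in> \<alpha>" "\<alpha> \<subseteq> {..<p}" for x y :: 'k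
    unfolding sign[OF that] by (simp only: mult_minus_left mult_minus_right mult.left_commute)
  then show "app (grading p * create p i) f \<alpha> = app (- (create p i * grading p)) f \<alpha>"
  proof (cases "\<alpha> \<subseteq> {..<p} \<and> i \<in> \<alpha>")
    case True
    then show ?thesis using swap[of "fock_sign i \<alpha>" "f (\<alpha> - {i})"] by auto
  qed auto
qed

lemma grading_annihilate: "grading p * annihilate p i = - (annihilate p i * grading p :: 'k::field op)"
  by (rule op_eqI) (auto simp: finite_subset_lessThan)

lemma grading_square: "grading p * grading p = (proj_op (Pow {..<p}) :: 'k::field op)"
  by (rule op_eqI) (auto simp flip: mult.assoc)

lemma fock_proj [simp]:
  "proj_op (Pow {..<p}) * create p i = (create p i :: 'k::field op)" "create p i * proj_op (Pow {..<p}) = (create p i :: 'k::field op)"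
  "proj_op (Pow {..<p}) * annihilate p i = (annihilate p i :: 'k::field op)" "annihilate p i * proj_op (Pow {..<p}) = (annihilate p i :: 'k::field op)"
  "proj_op (Pow {..<p}) * grading p = (grading p :: 'k::field op)" "grading p * proj_op (Pow {..<p}) = (grading p :: 'k::field op)"
  "proj_op D * proj_op D = (proj_op D :: 'k::field op)"
  by (auto intro!: op_eqI)

lemma square_sum_anticommuting:
  fixes b :: "'i \<Rightarrow> 'r::ring"
  assumes "finite A" "\<And>i j. i \<in> A \<Longrightarrow> j \<in> A \<Longrightarrow> i \<noteq> j \<Longrightarrow> b i * b j = - (b j * b i)"
  shows "sum b A * sum b A = (\<Sum>i\<in>A. b i * b i)"
  using assms
proof (induction A rule: finite_induct)
  case (insert a A)
  have "b a * sum b A + sum b A * b a = (\<Sum>i\<in>A. b a * b i + b i * b a)"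
    by (simp add: sum_distrib_left sum_distrib_right sum.distrib)
  also have "\<dots> = 0"
  proof (intro sum.neutral ballI)
    fix i assume "i \<in> A"
    then have "b a * b i = - (b i * b a)" using insert.hyps by (intro insert.prems) auto
    then show "b a * b i + b i * b a = 0" by (rule eq_neg_iff_add_eq_0[THEN iffD1])
  qed
  finally have *: "b a * sum b A = - (sum b A * b a)" by (rule eq_neg_iff_add_eq_0[THEN iffD2])
  have "sum b A * sum b A = (\<Sum>i\<in>A. b i * b i)" by (intro insert.IH insert.prems) auto
  then show ?case using insert.hyps by (simp add: distrib_left distrib_right *)
qed simp

text \<open>Each hyperbolic pair acts by creation and annihilation. The parity operator anticommutes
  with all of these and squares to the projection, so it can carry the one remaining direction in
  odd dimension.\<close>

definition fock_rep :: "nat \<Rightarrow> (nat \<Rightarrow> 'v \<Rightarrow> 'k) \<Rightarrow> (nat \<Rightarrow> 'v \<Rightarrow> 'k) \<Rightarrow> ('v \<Rightarrow> 'k) \<Rightarrow> 'v \<Rightarrow> 'k::field op" where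
  "fock_rep p a b c v = (\<Sum>i<p. scale_op (a i v) (create p i) + scale_op (b i v) (annihilate p i)) + scale_op (c v) (grading p)"

interpretation op: vector_space "scale_op :: 'k::field \<Rightarrow> _"
  by (rule vector_space_scale_op)

text \<open>All cross terms cancel by anticommutation; the \<open>i\<close>-th pair contributes
  \<open>a i v * b i v\<close> and the parity operator contributes the square of
  \<open>c v\<close>.\<close>

lemma fock_rep_square:
  fixes a b :: "nat \<Rightarrow> 'v \<Rightarrow> 'k::field"
  shows "fock_rep p a b c v * fock_rep p a b c v
     = scale_op ((\<Sum>i<p. a i v * b i v) + (c v)\<^sup>2) (proj_op (Pow {..<p}))"
proof -
  define t where "t i = scale_op (a i v) (create p i) + scale_op (b i v) (annihilate p i)" for i
  have anti: "t i * t j = - (t j * t i)" if "i \<noteq> j" for i j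
  proof -
    have 1: "create p j * annihilate p i = - (annihilate p i * create p j :: 'k op)" "create p i * annihilate p j = - (annihilate p j * create p i :: 'k op)"
      using create_annihilate that by metis+
    show ?thesis
      unfolding t_def distrib_left distrib_right scale_op_mult 1
        create_create[of p i j] annihilate_annihilate[of p i j]
      by (simp add: algebra_simps)
  qed
  have sq: "t i * t i = scale_op (a i v * b i v) (proj_op (Pow {..<p}))" if "i < p" for i
  proof -
    have "t i * t i = scale_op (a i v * b i v) (create p i * annihilate p i + annihilate p i * create p i)"
      by (simp add: t_def distrib_left distrib_right scale_op_mult op.scale_right_distrib mult.commute)
    then show ?thesis by (simp only: create_annihilate_same[OF that])
  qed
  have gt: "grading p * t i = - (t i * grading p)" for i
    by (simp add: t_def distrib_left distrib_right scale_op_mult grading_create grading_annihilate)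
  let ?s = "\<Sum>i<p. t i"
  have "grading p * ?s = - (?s * grading p)"
    by (simp add: sum_distrib_left sum_distrib_right gt sum_negf)
  moreover have "?s * ?s = (\<Sum>i<p. t i * t i)"
    by (intro square_sum_anticommuting anti) auto
  then have "?s * ?s = scale_op (\<Sum>i<p. a i v * b i v) (proj_op (Pow {..<p}))"
    by (simp add: sq op.scale_sum_left)
  moreover have "fock_rep p a b c v = ?s + scale_op (c v) (grading p)" by (simp add: fock_rep_def t_def)
  ultimately show ?thesis
    by (simp add: distrib_left distrib_right scale_op_mult grading_square op.scale_left_distrib
        op.scale_right_distrib power2_eq_square)
qed

lemma fock_rep_proj [simp]:
  "proj_op (Pow {..<p}) * fock_rep p a b c v = fock_rep p a b c v"
  "fock_rep p a b c v * proj_op (Pow {..<p}) = fock_rep p a b c v"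
  by (simp_all add: fock_rep_def distrib_left distrib_right sum_distrib_left sum_distrib_right scale_op_mult)

lemma fock_rep_linear:
  assumes "\<And>i. Vector_Spaces.linear sV (*) (a i)" "\<And>i. Vector_Spaces.linear sV (*) (b i)"
    "Vector_Spaces.linear sV (*) c"
  shows "Vector_Spaces.linear sV scale_op (fock_rep p a b c)"
  using assms unfolding Vector_Spaces.linear_iff fock_rep_def
  by (auto simp: vector_space_scale_op op.scale_left_distrib op.scale_right_distrib sum.distrib op.scale_sum_right)

lemma grading_fock_rep:
  "grading p * fock_rep p a b (\<lambda>_. 0) v = - (fock_rep p a b (\<lambda>_. 0) v * grading p)"
  by (simp add: fock_rep_def sum_distrib_left sum_distrib_right distrib_left distrib_right scale_op_mult
      grading_create grading_annihilate sum_negf[symmetric])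

section \<open>Quadrics of rank at most four\<close>

text \<open>Polarisation writes every \<open>associated_form q x\<close> as a combination of the
  four linear forms, so the image in the dual space has dimension at most 4.\<close>

lemma quadratic_form_rank_4:
  assumes l: "\<And>i. i \<in> {l1,l2,l3,l4} \<Longrightarrow> Vector_Spaces.linear sW (*) i"
    and q: "\<And>x. q x = l1 x * l2 x - l3 x * l4 x" and two: "(2::'k::field) \<noteq> 0"
  shows "quadratic_form sW q \<and> quadric_rank (q :: 'w::ab_group_add \<Rightarrow> 'k) \<le> 4"
proof
  have W: "vector_space sW" using l by (auto simp: Vector_Spaces.linear_iff)
  have lin: "i (x + y) = i x + i y" "i (sW c x) = c * i x" if "i \<in> {l1,l2,l3,l4}" for i x y c
    using l[OF that] by (auto simp: Vector_Spaces.linear_iff)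
  have "bilinear_form sW (\<lambda>x y. l1 x * l2 y - l3 x * l4 y)"
    unfolding bilinear_form_def Vector_Spaces.linear_iff
    using W by (auto simp: vector_space_field lin algebra_simps)
  then show "quadratic_form sW q" unfolding quadratic_form_def using q by blast
  have "range (associated_form q) \<subseteq> F.span {l1,l2,l3,l4}"
  proof
    fix h assume "h \<in> range (associated_form q)"
    then obtain x where h: "h = associated_form q x" by blast
    have "h = scale_fun (l2 x / 2) l1 + scale_fun (l1 x / 2) l2 + scale_fun (- l4 x / 2) l3 + scale_fun (- l3 x / 2) l4"
      using two by (auto simp: h fun_eq_iff associated_form_def q lin field_simps)
    also have "\<dots> \<in> F.span {l1,l2,l3,l4}"
      by (intro F.span_add F.span_scale F.span_base) auto
    finally show "h \<in> F.span {l1,l2,l3,l4}" .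
  qed
  then have "F.dim (range (associated_form q)) \<le> card {l1,l2,l3,l4}"
    by (intro F.dim_le_card) auto
  also have "\<dots> \<le> 4" by (intro card_insert_le_m1 order_trans[OF card_insert_le_m1]) (auto simp: card_insert_if)
  finally show "quadric_rank q \<le> 4" by (simp add: quadric_rank_def bilinear_form_rank_def)
qed

section \<open>Pure spinors\<close>

locale spin_rep = exterior_rep sV Basis B scale_op g I U sW p wedge
  for sV :: "'k::field \<Rightarrow> 'v::ab_group_add \<Rightarrow> 'v" and Basis and B and g and I and U
    and sW :: "'k \<Rightarrow> 'w::ab_group_add \<Rightarrow> 'w" and p and wedge +
  fixes D :: "nat set set"
  assumes D_finite: "finite D" and D_card: "card D = 2 ^ p" and I_proj: "I = proj_op D"
    and witt: "has_witt_index sV B p" and p_pos: "p \<ge> 1"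
begin

text \<open>The condition \<open>app I s = s\<close> restricts to the spinor space of dimension
  \<open>2 ^ p\<close> inside the space of all functions.\<close>

definition killed :: "'v list \<Rightarrow> (nat set \<Rightarrow> 'k) set" where
  "killed vs = {s. app I s = s \<and> (\<forall>v\<in>set vs. app (g v) s = 0)}"

text \<open>If \<open>v\<close> is isotropic and \<open>B f v = 1\<close>, then \<open>g f\<close> maps the spinors killed by \<open>v # vs\<close> injectively to a
  complement of these spinors among those killed by \<open>vs\<close>.\<close>

lemma killed_bound:
  assumes "isotropic_set (set vs)" "independent_list vs"
    and "finite T" "F.independent T" "T \<subseteq> killed vs"
  shows "card T * 2 ^ length vs \<le> 2 ^ p"
  using assms
proof (induction vs arbitrary: T)
  case Nil
  have "T \<subseteq> F.span (delta ` D)"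
  proof
    fix s assume "s \<in> T"
    then have "s = app I s" using Nil by (auto simp: killed_def)
    also have "\<dots> \<in> F.span (delta ` D)"
      unfolding I_proj proj_expand[OF D_finite] by (intro F.span_sum F.span_scale F.span_base) auto
    finally show "s \<in> F.span (delta ` D)" .
  qed
  then have "card T \<le> card (delta ` D :: (nat set \<Rightarrow> 'k) set)"
    using F.independent_span_bound[of "delta ` D" T] D_finite Nil by auto
  also have "\<dots> \<le> 2 ^ p" using card_image_le[OF D_finite] D_card by metis
  finally show ?case by simp
next
  case (Cons v vs)
  note iso = isotropic_set_Cons[OF Cons.prems(1)]
  obtain f where f: "B f v = 1" "\<And>w. w \<in> set vs \<Longrightarrow> B f w = 0"
    using separate_from_span[of v "set vs"] Cons.prems(2) by auto
  have TI: "app I t = t" and Tv: "app (g v) t = 0" and Tvs: "\<And>w. w \<in> set vs \<Longrightarrow> app (g w) t = 0"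
    if "t \<in> T" for t using that Cons.prems(5) by (auto simp: killed_def)
  have vf: "app (g v) (app (g f) t) = (\<lambda>\<alpha>. 2 * t \<alpha>)" if "t \<in> T" for t
  proof
    fix \<alpha>
    have "app (g f * g v + g v * g f) t \<alpha> = app (scale_op 2 I) t \<alpha>"
      using clifford[of f v] f(1) by simp
    then show "app (g v) (app (g f) t) \<alpha> = 2 * t \<alpha>" using TI Tv that by (simp add: app.zero)
  qed
  have t0: "t \<noteq> 0" if "t \<in> T" for t using that Cons.prems(4) F.dependent_zero by blast
  have inj: "inj_on (app (g f)) T"
  proof
    fix s t assume st: "s \<in> T" "t \<in> T" "app (g f) s = app (g f) t"
    then have "(\<lambda>\<alpha>. 2 * s \<alpha>) = (\<lambda>\<alpha>. 2 * t \<alpha>)" using vf by metis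
    then show "s = t" using two by (auto simp: fun_eq_iff)
  qed
  have disj: "T \<inter> app (g f) ` T = {}"
  proof (rule ccontr)
    assume "T \<inter> app (g f) ` T \<noteq> {}"
    then obtain t where t: "t \<in> T" "app (g f) t \<in> T" by blast
    then have "(\<lambda>\<alpha>. 2 * t \<alpha>) = 0" using vf Tv by metis
    then have "t = 0" using two by (auto simp: fun_eq_iff)
    then show False using t0 t by blast
  qed
  let ?T = "T \<union> app (g f) ` T"
  have "F.independent ?T"
  proof (rule F.independent_if_scalars_zero)
    show "finite ?T" using Cons.prems by simp
    fix c x assume sum: "(\<Sum>x\<in>?T. scale_fun (c x) x) = 0" and x: "x \<in> ?T"
    have split: "(\<Sum>t\<in>T. scale_fun (c t) t) + (\<Sum>t\<in>T. scale_fun (c (app (g f) t)) (app (g f) t)) = 0"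
      using sum Cons.prems(3) disj by (simp add: sum.union_disjoint sum.reindex[OF inj])
    \<comment> \<open>Applying \<open>g v\<close> removes the part in \<open>T\<close> and turns
      each \<open>g f t\<close> into \<open>2 t\<close>, so independence of \<open>T\<close> first
      kills the coefficients of the second half and then those of the first.\<close>
    have "app (g v) ((\<Sum>t\<in>T. scale_fun (c t) t) + (\<Sum>t\<in>T. scale_fun (c (app (g f) t)) (app (g f) t))) = 0"
      unfolding split by (rule app.zero)
    moreover have "app (g v) (\<Sum>t\<in>T. scale_fun (c t) t) = 0"
      unfolding app.sum app_scale using Tv by (intro sum.neutral) (auto simp: fun_eq_iff)
    moreover have "app (g v) (\<Sum>t\<in>T. scale_fun (c (app (g f) t)) (app (g f) t))
        = (\<Sum>t\<in>T. scale_fun (c (app (g f) t) * 2) t)"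
      unfolding app.sum app_scale using vf by (intro sum.cong) (auto simp: fun_eq_iff)
    ultimately have "(\<Sum>t\<in>T. scale_fun (c (app (g f) t) * 2) t) = 0"
      unfolding app.add by (simp only: add_0_left)
    from F.independentD[OF Cons.prems(4,3) subset_refl this]
    have c2: "c (app (g f) t) = 0" if "t \<in> T" for t
      using that two by simp
    have "(\<Sum>t\<in>T. scale_fun (c (app (g f) t)) (app (g f) t)) = 0"
      using c2 by (intro sum.neutral) (auto simp: fun_eq_iff)
    then have "(\<Sum>t\<in>T. scale_fun (c t) t) = 0" using split by (simp only: add_0_right)
    from F.independentD[OF Cons.prems(4,3) subset_refl this]
    have "c t = 0" if "t \<in> T" for t using that .
    then show "c x = 0" using x c2 by auto
  qed
  moreover have "?T \<subseteq> killed vs"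
  proof -
    have "app I (app (g f) t) = app (g f) t" for t using I_g[of f] by (metis app_simps(5))
    moreover have "app (g w) (app (g f) t) = 0" if "w \<in> set vs" "t \<in> T" for w t
    proof -
      have "g w * g f = - (g f * g w)" using f(2)[OF that(1)] by (intro anticommute) (simp add: B_sym)
      then have "app (g w * g f) t = app (- (g f * g w)) t" by simp
      then show ?thesis using Tvs[OF that(2,1)] by (simp add: fun_eq_iff app.zero)
    qed
    ultimately show ?thesis using TI Tvs by (auto simp: killed_def)
  qed
  ultimately have "card ?T * 2 ^ length vs \<le> 2 ^ p"
    using Cons.IH[of ?T] iso Cons.prems by simp
  moreover have "card ?T = card T * 2"
    using card_Un_disjoint[OF _ _ disj] card_image[OF inj] Cons.prems(3) by simp
  ultimately show ?case by (simp add: mult.assoc)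
qed

text \<open>Two independent killed spinors would give \<open>2 * 2 ^ p \<le> 2 ^ p\<close> in
  \<open>killed_bound\<close>.\<close>

lemma killed_line:
  assumes vs: "isotropic_set (set vs)" "independent_list vs" "length vs = p"
    and st: "s \<in> killed vs" "t \<in> killed vs" "s \<noteq> 0"
  shows "\<exists>c. t = (\<lambda>\<alpha>. c * s \<alpha>)"
proof (rule ccontr)
  assume ne: "\<not> ?thesis"
  then have "t \<notin> F.span {s}" by (auto simp: F.span_singleton)
  then have "F.independent {t, s}" "t \<noteq> s"
    using st(3) F.span_base[of s "{s}"] by (auto simp: F.independent_insert)
  then have "card {t, s} * 2 ^ length vs \<le> 2 ^ p" using vs st by (intro killed_bound) auto
  then show False using vs(3) \<open>t \<noteq> s\<close> by simp
qed

lemma P_range_killed: "isotropic_set (set vs) \<Longrightarrow> app (P vs) f \<in> killed vs"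
proof -
  assume iso: "isotropic_set (set vs)"
  have "app I (app (P vs) f) = app (P vs) f" by (metis I_P app_simps(5))
  moreover have "app (g v * P vs) f = 0" if "v \<in> set vs" for v
    using P_left_annihilated[OF iso V.span_base[OF that]] by (simp add: fun_eq_iff)
  ultimately show ?thesis by (simp add: killed_def)
qed

lemma P_range_line:
  assumes vs: "isotropic_set (set vs)" "independent_list vs" "length vs = p"
  obtains s where "s \<in> killed vs" "s \<noteq> 0" "\<And>f. \<exists>c. app (P vs) f = (\<lambda>\<alpha>. c * s \<alpha>)"
proof -
  obtain f where "app (P vs) f \<noteq> 0"
    using P_nonzero[OF vs(1,2)] by (metis app_simps(1) op_eqI zero_fun_apply)
  then show ?thesis
    using that[of "app (P vs) f"] killed_line[OF vs] P_range_killed[OF vs(1)] by blast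
qed

section \<open>The cone as the common zero locus of the minors\<close>

lemma Gr_iso_scale:
  assumes "w \<in> Gr_iso B p wedge" shows "sW c w \<in> Gr_iso B p wedge"
proof -
  obtain vs where vs: "length vs = p" "isotropic_set (set vs)" "w = wedge vs"
    using assms by (auto simp: Gr_iso_def isotropic_tuple_iff)
  interpret l: Vector_Spaces.linear sV sW "\<lambda>x. wedge (vs[0 := x])"
    using vs p_pos by (intro wedge_linear) auto
  \<comment> \<open>The scalar is absorbed into the first vector, which exists because
    \<open>p \<ge> 1\<close>.\<close>
  let ?vs = "vs[0 := sV c (vs ! 0)]"
  have "vs ! 0 \<in> set vs" using vs p_pos by simp
  then have "set ?vs \<subseteq> V.span (set vs)"
    by (metis V.span_base V.span_scale V.span_superset insert_subset order_trans set_update_subset_insert)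
  then have "isotropic_set (set ?vs)"
    using isotropic_set_span[OF vs(2)] by (auto simp: isotropic_subspace_def isotropic_set_def)
  moreover have "wedge ?vs = sW c w" using l.scale vs by simp
  ultimately have "isotropic_tuple B p ?vs" "sW c w = wedge ?vs"
    using vs by (simp_all add: isotropic_tuple_iff)
  then show ?thesis unfolding Gr_iso_def by blast
qed

definition minor :: "nat set \<Rightarrow> nat set \<Rightarrow> nat set \<Rightarrow> nat set \<Rightarrow> 'w \<Rightarrow> 'k" where
  "minor \<alpha> \<beta> \<gamma> \<delta> w = entry (rho w) \<alpha> \<beta> * entry (rho w) \<gamma> \<delta> - entry (rho w) \<alpha> \<delta> * entry (rho w) \<gamma> \<beta>"

definition minors :: "('w \<Rightarrow> 'k) set" where
  "minors = {minor \<alpha> \<beta> \<gamma> \<delta> | \<alpha> \<beta> \<gamma> \<delta>. \<alpha> \<in> D \<and> \<beta> \<in> D \<and> \<gamma> \<in> D \<and> \<delta> \<in> D}"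

lemma entry_scale: "entry (scale_op c x) \<alpha> \<beta> = c * entry x \<alpha> \<beta>"
  and entry_add: "entry (x + y) \<alpha> \<beta> = entry x \<alpha> \<beta> + entry y \<alpha> \<beta>"
  and entry_zero: "entry 0 \<alpha> \<beta> = 0"
  by (simp_all add: entry_def)

lemma minor_wedge:
  assumes "isotropic_set (set vs)" "length vs = p"
  shows "minor \<alpha> \<beta> \<gamma> \<delta> (wedge vs) = 0"
proof (cases "independent_list vs")
  case True
  obtain s where "\<And>f. \<exists>c. app (P vs) f = (\<lambda>\<alpha>. c * s \<alpha>)" using P_range_line[OF assms(1) True assms(2)] by blast
  from minors_0_if_range_line[OF this, of \<alpha> \<beta> \<gamma> \<delta>] show ?thesis
    by (simp add: minor_def rho_isotropic[OF assms] entry_scale)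
next
  case False
  then have "wedge vs = 0" using wedge_isotropic_nonzero_iff[OF assms] by blast
  then show ?thesis by (simp add: minor_def rho.zero entry_zero)
qed

lemma zero_in_Gr_iso: "0 \<in> Gr_iso B p wedge"
proof -
  have iso: "isotropic_set (set (replicate p 0))" by (auto simp: isotropic_set_def)
  have "\<not> independent_list (replicate p 0)" using p_pos by (cases p) (auto simp: V.span_zero)
  then have "wedge (replicate p 0) = 0" using wedge_isotropic_nonzero_iff[OF iso] by auto
  then show ?thesis using iso
    by (auto simp: Gr_iso_def isotropic_tuple_iff intro!: exI[of _ "replicate p 0"])
qed

lemma Gr_iso_eq_minors: "Gr_iso B p wedge = zero_locus minors"
proof (intro equalityI subsetI)
  fix w assume "w \<in> Gr_iso B p wedge"
  then obtain vs where "w = wedge vs" "isotropic_set (set vs)" "length vs = p"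
    by (auto simp: Gr_iso_def isotropic_tuple_iff)
  then show "w \<in> zero_locus minors"
    using minor_wedge[of vs] by (auto simp: zero_locus_def minors_def)
next
  fix w assume w: "w \<in> zero_locus minors"
  show "w \<in> Gr_iso B p wedge"
  proof (cases "w = 0")
    case False
    let ?x = "rho w"
    have x: "?x \<noteq> 0" using rho_injective False by blast
    have rank_one: "\<exists>k. ?x * y * ?x = scale_op k ?x" for y
    proof (rule rank_one_if_minors_0[OF D_finite])
      fix \<alpha> \<beta> \<gamma> \<delta> assume "\<alpha> \<in> D" "\<beta> \<in> D" "\<gamma> \<in> D" "\<delta> \<in> D"
      then have "minor \<alpha> \<beta> \<gamma> \<delta> w = 0" using w unfolding zero_locus_def minors_def by blast
      then show "entry ?x \<alpha> \<beta> * entry ?x \<gamma> \<delta> = entry ?x \<alpha> \<delta> * entry ?x \<gamma> \<beta>" by (simp add: minor_def)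
    qed (simp_all flip: I_proj)
    let ?N = "{v. g v * ?x = 0}"
    have max: "maximal_isotropic_subspace sV B ?N"
      by (rule annihilator_maximal_isotropic[OF casimir_rho I_rho rho_I x rank_one])
    \<comment> \<open>The Witt index supplies exactly the \<open>p\<close> vectors needed for a
      wedge in degree \<open>p\<close>.\<close>
    then have dim: "V.dim ?N = p" using witt by (auto simp: has_witt_index_def)
    obtain T where T: "T \<subseteq> ?N" "V.independent T" "?N \<subseteq> V.span T" "card T = p"
      using V.basis_exists[of ?N] dim by metis
    then have "finite T" using V.finiteI_independent by blast
    then obtain ws where ws: "set ws = T" "distinct ws" using finite_distinct_list by blast
    have iso: "isotropic_set (set ws)"
      using max T(1) ws unfolding maximal_isotropic_subspace_def isotropic_subspace_def isotropic_set_def by blast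
    have ind: "independent_list ws" using ws T by (simp add: independent_list_iff)
    have len: "length ws = p" using ws T distinct_card by fastforce
    obtain s where s: "\<And>f. \<exists>c. app (P ws) f = (\<lambda>\<alpha>. c * s \<alpha>)"
      using P_range_line[OF iso ind len] by blast
    have "\<exists>k. ?x = scale_op k (P ws)"
    proof (rule proportional_to_P[OF casimir_rho I_rho rho_I iso ind])
      show "g v * ?x = 0" if "v \<in> set ws" for v using that ws T(1) by blast
    qed (rule rank_one_if_range_line[OF s])
    then obtain k where k: "?x = scale_op k (P ws)" by blast
    \<comment> \<open>The power of 2 undoes the factor by which \<open>rho (wedge ws)\<close>
      differs from \<open>P ws\<close>; injectivity of \<open>rho\<close> then identifies
      \<open>w\<close>.\<close>
    have "rho (sW (k / 2 ^ p) (wedge ws)) = ?x"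
      using two by (simp add: rho.scale rho_isotropic[OF iso len] k)
    then have "rho (sW (k / 2 ^ p) (wedge ws) - w) = 0" by (simp add: rho.diff)
    then have "w = sW (k / 2 ^ p) (wedge ws)" using rho_injective by fastforce
    moreover have "wedge ws \<in> Gr_iso B p wedge" using iso len by (auto simp: Gr_iso_def isotropic_tuple_iff)
    ultimately show ?thesis using Gr_iso_scale by simp
  qed (simp add: zero_in_Gr_iso)
qed

text \<open>The left factor \<open>y\<close> is \<open>I\<close> for the entries occurring in the
  minors and \<open>\<Gamma> - scale_op \<epsilon> I\<close> for the linear forms that cut out a
  component.\<close>

lemma entry_linear: "Vector_Spaces.linear sW (*) (\<lambda>w. entry (y * rho w) \<alpha> \<beta>)"
  by (auto simp: Vector_Spaces.linear_iff W.vector_space_axioms vector_space_field rho.add rho.scale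
      entry_add entry_scale distrib_left)

end

context spin_rep begin

lemma minors_quadrics: "q \<in> minors \<Longrightarrow> quadratic_form sW q \<and> quadric_rank q \<le> 4"
proof -
  assume "q \<in> minors"
  then obtain \<alpha> \<beta> \<gamma> \<delta> where q: "q = minor \<alpha> \<beta> \<gamma> \<delta>" by (auto simp: minors_def)
  have "Vector_Spaces.linear sW (*) (\<lambda>w. entry (rho w) \<alpha> \<beta>)" for \<alpha> \<beta>
    using entry_linear[of I \<alpha> \<beta>] by simp
  then show ?thesis
    by (intro quadratic_form_rank_4[of "\<lambda>w. entry (rho w) \<alpha> \<beta>" "\<lambda>w. entry (rho w) \<gamma> \<delta>"
          "\<lambda>w. entry (rho w) \<alpha> \<delta>" "\<lambda>w. entry (rho w) \<gamma> \<beta>"]) (auto simp: q minor_def two)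
qed

end

section \<open>Parity and the two families in even dimension\<close>

locale graded_spin_rep = spin_rep sV Basis B g I U sW p wedge D
  for sV :: "'k::field \<Rightarrow> 'v::ab_group_add \<Rightarrow> 'v" and Basis and B and g and I and U
    and sW :: "'k \<Rightarrow> 'w::ab_group_add \<Rightarrow> 'w" and p and wedge and D +
  fixes \<Gamma> :: "'k op"
  assumes \<Gamma>_square: "\<Gamma> * \<Gamma> = I" and \<Gamma>_anticommute: "\<Gamma> * g v = - (g v * \<Gamma>)"
    and I_\<Gamma> [simp]: "I * \<Gamma> = \<Gamma>" and \<Gamma>_I [simp]: "\<Gamma> * I = \<Gamma>"
begin

lemma \<Gamma>_anticommute_left: "\<Gamma> * (g v * x) = - (g v * (\<Gamma> * x))"
  using \<Gamma>_anticommute by (simp flip: mult.assoc)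

lemma \<Gamma>_P: "\<Gamma> * P vs = scale_op ((-1) ^ length vs) (P vs * \<Gamma>)"
  by (induction vs) (simp_all add: \<Gamma>_anticommute_left mult.assoc)

lemma app_\<Gamma>_g: "app \<Gamma> (app (g v) s) = - app (g v) (app \<Gamma> s)"
proof -
  have "app (\<Gamma> * g v) s = app (- (g v * \<Gamma>)) s" by (simp only: \<Gamma>_anticommute)
  then show ?thesis by (simp add: fun_eq_iff)
qed

lemma killed_\<Gamma>: "s \<in> killed vs \<Longrightarrow> app \<Gamma> s \<in> killed vs"
proof -
  assume s: "s \<in> killed vs"
  have "app I (app \<Gamma> s) = app \<Gamma> s" by (metis I_\<Gamma> app_simps(5))
  moreover have "app (g v) (app \<Gamma> s) = 0" if "v \<in> set vs" for v
    using app_\<Gamma>_g[of v s] s that by (simp add: killed_def app.zero)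
  ultimately show ?thesis by (simp add: killed_def)
qed

definition has_sign :: "'v list \<Rightarrow> 'k \<Rightarrow> bool" where
  "has_sign vs \<epsilon> \<longleftrightarrow> (\<forall>s\<in>killed vs. app \<Gamma> s = (\<lambda>\<alpha>. \<epsilon> * s \<alpha>))"

text \<open>\<open>\<Gamma>\<close> anticommutes with every \<open>g v\<close>, hence preserves the
  line of killed spinors and acts there by a scalar; \<open>\<Gamma> * \<Gamma> = I\<close> makes
  its square 1.\<close>

lemma sign_exists:
  assumes vs: "isotropic_set (set vs)" "independent_list vs" "length vs = p"
  obtains \<epsilon> where "\<epsilon> * \<epsilon> = 1" "has_sign vs \<epsilon>"
proof -
  obtain s where s: "s \<in> killed vs" "s \<noteq> 0" using P_range_line[OF vs] by blast
  obtain \<epsilon> where \<epsilon>: "app \<Gamma> s = (\<lambda>\<alpha>. \<epsilon> * s \<alpha>)"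
    using killed_line[OF vs s(1) killed_\<Gamma>[OF s(1)] s(2)] by blast
  have "app (\<Gamma> * \<Gamma>) s = (\<lambda>\<alpha>. \<epsilon> * (\<epsilon> * s \<alpha>))" by (simp add: \<epsilon> app_scale)
  then have "s = (\<lambda>\<alpha>. \<epsilon> * (\<epsilon> * s \<alpha>))" using s(1) by (simp add: \<Gamma>_square killed_def)
  then have "s \<alpha> = (\<epsilon> * \<epsilon>) * s \<alpha>" for \<alpha> by (metis mult.assoc)
  moreover obtain \<alpha> where "s \<alpha> \<noteq> 0" using s(2) by (auto simp: fun_eq_iff)
  ultimately have "\<epsilon> * \<epsilon> = 1" by (metis mult_cancel_right1)
  moreover have "has_sign vs \<epsilon>"
    unfolding has_sign_def
  proof
    fix t assume "t \<in> killed vs"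
    then obtain c where "t = (\<lambda>\<alpha>. c * s \<alpha>)" using killed_line[OF vs s(1) _ s(2)] by blast
    then show "app \<Gamma> t = (\<lambda>\<alpha>. \<epsilon> * t \<alpha>)" by (simp add: app_scale \<epsilon> mult.left_commute)
  qed
  ultimately show ?thesis using that by blast
qed

lemma has_sign_unique:
  assumes vs: "isotropic_set (set vs)" "independent_list vs" "length vs = p"
    and "s \<in> killed vs" "s \<noteq> 0" "app \<Gamma> s = (\<lambda>\<alpha>. \<epsilon> * s \<alpha>)" "has_sign vs \<epsilon>'"
  shows "\<epsilon> = \<epsilon>'"
proof -
  obtain \<alpha> where "s \<alpha> \<noteq> 0" using assms(5) by (auto simp: fun_eq_iff)
  moreover have "\<epsilon> * s \<alpha> = \<epsilon>' * s \<alpha>" using assms(4,6,7) by (metis has_sign_def)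
  ultimately show ?thesis by simp
qed

text \<open>The range of \<open>rho (wedge vs)\<close> is the line of killed spinors, so the sign
  can be read from an equation linear in the point of the cone. It also shows that the sign depends
  only on \<open>wedge vs\<close>.\<close>

lemma has_sign_iff:
  assumes vs: "isotropic_set (set vs)" "independent_list vs" "length vs = p"
  shows "has_sign vs \<epsilon> \<longleftrightarrow> \<Gamma> * rho (wedge vs) = scale_op \<epsilon> (rho (wedge vs))"
proof -
  have "\<Gamma> * rho (wedge vs) = scale_op \<epsilon> (rho (wedge vs)) \<longleftrightarrow>
      scale_op (2 ^ p) (\<Gamma> * P vs) = scale_op (2 ^ p) (scale_op \<epsilon> (P vs))"
    by (simp add: rho_isotropic[OF vs(1,3)] mult.commute)
  also have "\<dots> \<longleftrightarrow> \<Gamma> * P vs = scale_op \<epsilon> (P vs)" using two by (subst R.scale_cancel_left) simp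
  also have "\<dots> \<longleftrightarrow> has_sign vs \<epsilon>"
  proof
    assume "has_sign vs \<epsilon>"
    then show "\<Gamma> * P vs = scale_op \<epsilon> (P vs)"
      using P_range_killed[OF vs(1)] by (intro op_eqI) (simp add: has_sign_def)
  next
    assume eq: "\<Gamma> * P vs = scale_op \<epsilon> (P vs)"
    obtain f where f: "app (P vs) f \<noteq> 0"
      using P_nonzero[OF vs(1,2)] by (metis app_simps(1) op_eqI zero_fun_apply)
    obtain \<epsilon>' where \<epsilon>': "has_sign vs \<epsilon>'" using sign_exists[OF vs] by blast
    have "app (\<Gamma> * P vs) f = app (scale_op \<epsilon> (P vs)) f" by (simp only: eq)
    then have "app \<Gamma> (app (P vs) f) = (\<lambda>\<alpha>. \<epsilon> * app (P vs) f \<alpha>)" by (simp add: fun_eq_iff)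
    then have "\<epsilon> = \<epsilon>'" using has_sign_unique[OF vs P_range_killed[OF vs(1)] f _ \<epsilon>'] by blast
    then show "has_sign vs \<epsilon>" using \<epsilon>' by simp
  qed
  finally show ?thesis by blast
qed

text \<open>The vector \<open>w\<close> maps the line of killed spinors to itself, but exchanges the two parities.\<close>

lemma orthogonal_kills:
  assumes vs: "isotropic_set (set vs)" "independent_list vs" "length vs = p"
    and s: "s \<in> killed vs" and w: "\<And>v. v \<in> set vs \<Longrightarrow> B w v = 0"
  shows "app (g w) s = 0"
proof (cases "s = 0")
  case False
  obtain \<epsilon> where \<epsilon>: "\<epsilon> * \<epsilon> = 1" "has_sign vs \<epsilon>" using sign_exists[OF vs] by blast
  have "app (g w) s \<in> killed vs"
  proof -
    have "app I (app (g w) s) = app (g w) s" by (metis I_g app_simps(5))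
    moreover have "app (g v) (app (g w) s) = 0" if "v \<in> set vs" for v
    proof -
      have "g v * g w = - (g w * g v)" using w[OF that] by (intro anticommute) (simp add: B_sym)
      then have "app (g v) (app (g w) s) = app (- (g w * g v)) s" by (metis app_simps(5))
      moreover have "app (g v) s = 0" using s that by (simp add: killed_def)
      ultimately show ?thesis by (simp add: fun_eq_iff app.zero)
    qed
    ultimately show ?thesis by (simp add: killed_def)
  qed
  then have "app \<Gamma> (app (g w) s) = (\<lambda>\<alpha>. \<epsilon> * app (g w) s \<alpha>)" using \<epsilon>(2) by (simp add: has_sign_def)
  moreover have "app \<Gamma> (app (g w) s) = (\<lambda>\<alpha>. - (\<epsilon> * app (g w) s \<alpha>))"
    using \<epsilon>(2) s by (simp add: app_\<Gamma>_g has_sign_def app_scale) (simp add: fun_eq_iff)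
  ultimately have "\<epsilon> * app (g w) s \<alpha> = - (\<epsilon> * app (g w) s \<alpha>)" for \<alpha> by metis
  then have "2 * (\<epsilon> * app (g w) s \<alpha>) = 0" for \<alpha> by (metis add.right_inverse mult_2)
  moreover have "\<epsilon> \<noteq> 0" using \<epsilon>(1) by auto
  ultimately show ?thesis using two by (simp add: fun_eq_iff)
qed (simp add: app.zero)

text \<open>Let \<open>w\<close> be dual to \<open>u\<close> and orthogonal to
  \<open>us @ vs\<close>. By \<open>orthogonal_kills\<close>, \<open>g w\<close> kills
  \<open>s\<close> and hence \<open>P us\<close> applied to \<open>s\<close>; were the latter killed
  by \<open>g u\<close> too, the Clifford relation would make it zero.\<close>

lemma P_app_nonzero:
  assumes vs: "isotropic_set (set vs)" "independent_list vs" "length vs = p"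
    and s: "s \<in> killed vs" "s \<noteq> 0"
  shows "independent_list (us @ vs) \<Longrightarrow> app (P us) s \<noteq> 0"
proof (induction us)
  case Nil
  have "app I s = s" using s(1) by (simp add: killed_def)
  then show ?case using s(2) by (metis P.simps(1))
next
  case (Cons u us)
  let ?t = "app (P us) s"
  obtain w where w: "B w u = 1" "\<And>a. a \<in> set (us @ vs) \<Longrightarrow> B w a = 0"
    using separate_from_span[of u "set (us @ vs)"] Cons.prems by auto
  have ws: "app (g w) s = 0" using orthogonal_kills[OF vs s(1)] w(2) by simp
  have "app (P us * g w) s = app (scale_op ((-1) ^ length us) (g w * P us)) s"
    using P_commute[of us w] w(2) by simp
  then have wt: "app (g w) ?t = 0" using ws by (simp add: fun_eq_iff app.zero)
  have It: "app I ?t = ?t" by (metis I_P app_simps(5))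
  show ?case
  proof
    assume 0: "app (P (u # us)) s = 0"
    have "app (g w * g u + g u * g w) ?t = app (scale_op 2 I) ?t" using clifford[of w u] w(1) by simp
    then have "app (g w) (app (g u) ?t) \<alpha> + app (g u) (app (g w) ?t) \<alpha> = 2 * ?t \<alpha>" for \<alpha>
      using It by (simp add: fun_eq_iff)
    moreover have "app (g u) ?t = 0" using 0 by simp
    ultimately have "2 * ?t \<alpha> = 0" for \<alpha> using wt by (simp add: app.zero)
    then have "?t = 0" using two by (simp add: fun_eq_iff)
    then show False using Cons by simp
  qed
qed

text \<open>A relation between \<open>us\<close> and \<open>vs\<close> puts an element of
  \<open>span vs\<close> into \<open>span ws\<close>, hence into \<open>span T0\<close>, and so
  yields a relation inside the independent set \<open>T\<close>.\<close>

lemma independent_list_append: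
  assumes "V.independent T" "T0 \<subseteq> T" "T \<subseteq> V.span (set ws)"
    and meet: "V.span (set vs) \<inter> V.span (set ws) \<subseteq> V.span T0" and vs: "independent_list vs"
  shows "distinct us \<Longrightarrow> set us \<subseteq> T - T0 \<Longrightarrow> independent_list (us @ vs)"
proof (induction us)
  case (Cons u us)
  have "u \<notin> V.span (set (us @ vs))"
  proof
    assume "u \<in> V.span (set (us @ vs))"
    then obtain a n where u: "u = a + n" "a \<in> V.span (set us)" "n \<in> V.span (set vs)"
      using V.span_Un by auto
    have "set us \<subseteq> V.span (set ws)" "u \<in> V.span (set ws)" using Cons.prems assms(3) by auto
    then have "u - a \<in> V.span (set ws)" using u(2) V.span_diff V.span_minimal V.subspace_span by blast
    then have "n \<in> V.span T0" using u meet by auto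
    moreover have "set us \<subseteq> T - {u}" "T0 \<subseteq> T - {u}" using Cons.prems assms(2) by auto
    ultimately have "u \<in> V.span (T - {u})"
      using u V.span_mono[of "set us" "T - {u}"] V.span_mono[of T0 "T - {u}"] V.span_add[of a "T - {u}" n] by auto
    then show False using assms(1) Cons.prems by (auto simp: V.dependent_def)
  qed
  then show ?case using Cons by simp
qed (use vs in simp)

lemma dim_span_list: "independent_list vs \<Longrightarrow> V.dim (V.span (set vs)) = length vs"
  by (simp add: independent_list_iff V.dim_eq_card_independent distinct_card)

text \<open>Complete a basis \<open>T0\<close> of the intersection to a basis \<open>T\<close> of
  \<open>span ws\<close> by vectors \<open>us\<close>. Multiplying a spinor killed by
  \<open>vs\<close> with \<open>P us\<close> gives a nonzero spinor killed by \<open>ws\<close>, and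
  each factor flips the parity. The number of factors is \<open>p\<close> minus the dimension of the
  intersection, of the same parity as their sum.\<close>

lemma sign_relation:
  assumes vs: "isotropic_set (set vs)" "independent_list vs" "length vs = p"
    and ws: "isotropic_set (set ws)" "independent_list ws" "length ws = p"
    and \<epsilon>: "has_sign vs \<epsilon>" "has_sign ws \<epsilon>'"
  shows "\<epsilon>' = (-1) ^ (p + V.dim (V.span (set vs) \<inter> V.span (set ws))) * \<epsilon>"
proof -
  let ?X = "V.span (set vs) \<inter> V.span (set ws)"
  obtain T0 where T0: "T0 \<subseteq> ?X" "V.independent T0" "?X \<subseteq> V.span T0" "card T0 = V.dim ?X"
    by (rule V.basis_exists)
  obtain T where T: "T0 \<subseteq> T" "T \<subseteq> V.span (set ws)" "V.independent T" "V.span (set ws) \<subseteq> V.span T"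
    using V.maximal_independent_subset_extend[of T0 "V.span (set ws)"] T0 by blast
  have fin: "finite T" using T V.finiteI_independent by blast
  have cT: "card T = p"
    using V.basis_card_eq_dim[OF T(2,4,3)] dim_span_list[OF ws(2)] ws(3) by simp
  obtain us where us: "set us = T - T0" "distinct us" using finite_distinct_list fin by blast
  have len: "length us + V.dim ?X = p"
    using distinct_card[OF us(2)] us(1) card_Diff_subset[of T0 T] T(1) fin T0(4) cT card_mono[OF fin T(1)] finite_subset
    by (metis le_add_diff_inverse2)
  have ind: "independent_list (us @ vs)"
    using independent_list_append[OF T(3,1,2) T0(3) vs(2) us(2)] us(1) by simp
  have wspan: "B a b = 0" if "a \<in> V.span (set ws)" "b \<in> V.span (set ws)" for a b
    using isotropic_set_span[OF ws(1)] that by (auto simp: isotropic_subspace_def)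
  have us_iso: "isotropic_set (set us)"
    using wspan us(1) T(2) by (auto simp: isotropic_set_def subset_iff)
  obtain s where s: "s \<in> killed vs" "s \<noteq> 0" using P_range_line[OF vs] by blast
  let ?t = "app (P us) s"
  have t0: "?t \<noteq> 0" by (rule P_app_nonzero[OF vs s ind])
  have sub: "V.subspace {v. app (g v) f = 0}" for f
    by (auto simp: V.subspace_def g_simps fun_eq_iff)
  \<comment> \<open>Vectors outside \<open>T0\<close> occur in \<open>P us\<close> and kill it;
    vectors in \<open>T0\<close> kill \<open>s\<close> and pass through \<open>P us\<close> up to
    sign.\<close>
  have tT: "app (g v) ?t = 0" if "v \<in> T" for v
  proof (cases "v \<in> T0")
    case False
    then have "g v * P us = 0" using P_left_annihilated[OF us_iso V.span_base] us(1) that by blast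
    then have "app (g v * P us) s = app 0 s" by simp
    then show ?thesis by (simp add: fun_eq_iff)
  next
    case True
    then have "v \<in> V.span (set vs)" using T0(1) by blast
    then have vs0: "app (g v) s = 0"
      using V.span_minimal[OF _ sub[of s], of "set vs"] s(1) by (auto simp: killed_def)
    have "P us * g v = scale_op ((-1) ^ length us) (g v * P us)"
      using wspan T(2) that us(1) by (intro P_commute) auto
    then have "app (P us * g v) s = app (scale_op ((-1) ^ length us) (g v * P us)) s" by simp
    then show ?thesis by (simp add: fun_eq_iff vs0 app.zero)
  qed
  have "set ws \<subseteq> {v. app (g v) ?t = 0}"
    using V.span_minimal[OF _ sub[of ?t], of T] tT T(4) V.span_superset[of "set ws"] by blast
  moreover have "app I ?t = ?t" by (metis I_P app_simps(5))
  ultimately have tk: "?t \<in> killed ws" by (auto simp: killed_def)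
  have "app \<Gamma> ?t = app (\<Gamma> * P us) s" by simp
  also have "\<dots> = (\<lambda>\<alpha>. (-1) ^ length us * \<epsilon> * ?t \<alpha>)"
  proof -
    have "app \<Gamma> s = (\<lambda>\<alpha>. \<epsilon> * s \<alpha>)" using \<epsilon>(1) s(1) by (simp add: has_sign_def)
    then have "app (P us) (app \<Gamma> s) = (\<lambda>\<alpha>. \<epsilon> * ?t \<alpha>)" by (simp add: app_scale)
    then show ?thesis unfolding \<Gamma>_P by (simp add: fun_eq_iff)
  qed
  finally have "(-1) ^ length us * \<epsilon> = \<epsilon>'"
    using has_sign_unique[OF ws tk t0 _ \<epsilon>(2)] by blast
  moreover have "(-1 :: 'k) ^ (p + V.dim ?X) = (-1) ^ length us"
    by (simp flip: len add: power_add mult.assoc)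
  ultimately show ?thesis by simp
qed

lemma component_eq:
  assumes "C \<in> Gr_iso_components sV B p wedge"
  obtains \<epsilon> where "C = {w \<in> Gr_iso B p wedge. \<Gamma> * rho w = scale_op \<epsilon> (rho w)}"
proof -
  obtain x where x: "x \<in> Gr_iso B p wedge" "x \<noteq> 0" "C = insert 0 {y. same_family sV B p wedge x y}"
    using assms by (auto simp: Gr_iso_components_def)
  have iso: "isotropic_set (set vs)" "length vs = p" if "isotropic_tuple B p vs" for vs
    using that by (auto simp: isotropic_tuple_iff)
  have ind: "independent_list vs" if "isotropic_tuple B p vs" "wedge vs \<noteq> 0" for vs
    using wedge_isotropic_nonzero_iff[OF iso[OF that(1)]] that(2) by blast
  have sign: "(-1 :: 'k) ^ (p + d) = 1 \<longleftrightarrow> [d = p] (mod 2)" for d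
  proof -
    have "(-1 :: 'k) \<noteq> 1" using two by (metis add_neg_numeral_special(8) one_add_one)
    then have "(-1 :: 'k) ^ (p + d) = 1 \<longleftrightarrow> even (p + d)" by (cases "even (p + d)") auto
    also have "\<dots> \<longleftrightarrow> [d = p] (mod 2)" unfolding cong_def by presburger
    finally show ?thesis .
  qed
  obtain vs where vs: "isotropic_tuple B p vs" "x = wedge vs" using x(1) by (auto simp: Gr_iso_def)
  have vsi: "independent_list vs" using ind vs x(2) by blast
  obtain \<epsilon> where \<epsilon>: "\<epsilon> * \<epsilon> = 1" "has_sign vs \<epsilon>" using sign_exists[OF iso(1)[OF vs(1)] vsi iso(2)[OF vs(1)]] by blast
  have \<epsilon>0: "\<epsilon> \<noteq> 0" using \<epsilon>(1) by auto
  \<comment> \<open>\<open>same_family\<close> may use any tuple \<open>us\<close> representing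
    \<open>x\<close>, so the equivalence is proved for all of them; each has the sign
    \<open>\<epsilon>\<close> of the chosen \<open>vs\<close>.\<close>
  have key: "[V.dim (V.span (set us) \<inter> V.span (set ws)) = p] (mod 2) \<longleftrightarrow> \<Gamma> * rho (wedge ws) = scale_op \<epsilon> (rho (wedge ws))"
    if us: "isotropic_tuple B p us" "wedge us = x" and ws: "isotropic_tuple B p ws" "wedge ws \<noteq> 0" for us ws
  proof -
    have usi: "independent_list us" using ind us x(2) by blast
    have wsi: "independent_list ws" using ind ws by blast
    note U = iso(1)[OF us(1)] usi iso(2)[OF us(1)]
    note V = iso(1)[OF vs(1)] vsi iso(2)[OF vs(1)]
    note W = iso(1)[OF ws(1)] wsi iso(2)[OF ws(1)]
    have e: "has_sign us \<epsilon>" using \<epsilon>(2) has_sign_iff[OF U] has_sign_iff[OF V] us(2) vs(2) by simp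
    obtain \<epsilon>' where \<epsilon>': "has_sign ws \<epsilon>'" using sign_exists[OF W] by blast
    have rel: "\<epsilon>' = (-1) ^ (p + V.dim (V.span (set us) \<inter> V.span (set ws))) * \<epsilon>"
      by (rule sign_relation[OF U W e \<epsilon>'])
    obtain s where s: "s \<in> killed ws" "s \<noteq> 0" using P_range_line[OF W] by blast
    have "has_sign ws \<epsilon> \<longleftrightarrow> \<epsilon> = \<epsilon>'"
      using has_sign_unique[OF W s _ \<epsilon>', of \<epsilon>] \<epsilon>' s(1) by (auto simp: has_sign_def)
    also have "\<dots> \<longleftrightarrow> (-1 :: 'k) ^ (p + V.dim (V.span (set us) \<inter> V.span (set ws))) = 1"
      unfolding rel using \<epsilon>0 by auto
    finally show ?thesis unfolding has_sign_iff[OF W] sign by blast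
  qed
  have "C = {w \<in> Gr_iso B p wedge. \<Gamma> * rho w = scale_op \<epsilon> (rho w)}"
  proof (intro equalityI subsetI)
    fix y assume "y \<in> C"
    then consider "y = 0" | "same_family sV B p wedge x y" using x(3) by blast
    then show "y \<in> {w \<in> Gr_iso B p wedge. \<Gamma> * rho w = scale_op \<epsilon> (rho w)}"
    proof cases
      case 1
      then show ?thesis using zero_in_Gr_iso by (simp add: rho.zero)
    next
      case 2
      then obtain us ws where "isotropic_tuple B p us" "isotropic_tuple B p ws" "x = wedge us" "y = wedge ws" "y \<noteq> 0"
        "[V.dim (V.span (set us) \<inter> V.span (set ws)) = p] (mod 2)"
        by (auto simp: same_family_def)
      then show ?thesis using key[of us ws] by (auto simp: Gr_iso_def)
    qed
  next
    fix y assume y: "y \<in> {w \<in> Gr_iso B p wedge. \<Gamma> * rho w = scale_op \<epsilon> (rho w)}"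
    then obtain ws where ws: "isotropic_tuple B p ws" "y = wedge ws" by (auto simp: Gr_iso_def)
    show "y \<in> C"
    proof (cases "y = 0")
      case False
      then have "same_family sV B p wedge x y"
        using key[of vs ws] vs ws x(2) y by (auto simp: same_family_def)
      then show ?thesis using x(3) by blast
    qed (simp add: x(3))
  qed
  then show ?thesis by (rule that)
qed

lemma component_linear_forms:
  "\<exists>L. (\<forall>l\<in>L. Vector_Spaces.linear sW (*) l) \<and>
       zero_locus L = {w. \<Gamma> * rho w = scale_op \<epsilon> (rho w)}"
proof (intro exI conjI)
  let ?y = "\<Gamma> - scale_op \<epsilon> I"
  let ?L = "{\<lambda>w. entry (?y * rho w) \<alpha> \<beta> | \<alpha> \<beta>. \<alpha> \<in> D \<and> \<beta> \<in> D}"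
  show "\<forall>l\<in>?L. Vector_Spaces.linear sW (*) l" using entry_linear by blast
  have eq: "?y * rho w = \<Gamma> * rho w - scale_op \<epsilon> (rho w)" for w by (simp add: left_diff_distrib)
  have "w \<in> zero_locus ?L \<longleftrightarrow> ?y * rho w = 0" for w
  proof
    assume w: "w \<in> zero_locus ?L"
    show "?y * rho w = 0"
    proof (rule entries_0[OF D_finite])
      show "?y * rho w * proj_op D = ?y * rho w" by (simp add: mult.assoc flip: I_proj)
      show "proj_op D * (?y * rho w) = ?y * rho w"
        by (simp add: right_diff_distrib flip: I_proj mult.assoc)
      show "entry (?y * rho w) \<alpha> \<beta> = 0" if "\<alpha> \<in> D" "\<beta> \<in> D" for \<alpha> \<beta>
      proof -
        have "(\<lambda>w. entry (?y * rho w) \<alpha> \<beta>) \<in> ?L" using that by blast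
        from bspec[OF CollectD[OF w[unfolded zero_locus_def]] this] show ?thesis by simp
      qed
    qed
  next
    assume "?y * rho w = 0"
    then show "w \<in> zero_locus ?L" by (auto simp: zero_locus_def entry_zero)
  qed
  then show "zero_locus ?L = {w. \<Gamma> * rho w = scale_op \<epsilon> (rho w)}" unfolding eq by auto
qed

end

section \<open>Rescaling the form and constructing the spinor model\<close>

lemma isotropic_subspace_scale:
  fixes \<kappa> :: "'k::field"
  shows "\<kappa> \<noteq> 0 \<Longrightarrow> isotropic_subspace s (\<lambda>x y. \<kappa> * B x y) L \<longleftrightarrow> isotropic_subspace s B L"
  by (simp add: isotropic_subspace_def)

lemma has_witt_index_scale:
  fixes \<kappa> :: "'k::field"
  shows "\<kappa> \<noteq> 0 \<Longrightarrow> has_witt_index s (\<lambda>x y. \<kappa> * B x y) n \<longleftrightarrow> has_witt_index s B n"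
  by (simp add: has_witt_index_def maximal_isotropic_subspace_def isotropic_subspace_scale)

lemma Gr_iso_rescale:
  fixes \<kappa> :: "'k::field"
  shows "\<kappa> \<noteq> 0 \<Longrightarrow> Gr_iso (\<lambda>x y. \<kappa> * B x y) p wedge = Gr_iso B p wedge"
  by (simp add: Gr_iso_def isotropic_tuple_def)

context quadratic_space begin

lemma rescaled: "\<kappa> \<noteq> 0 \<Longrightarrow> quadratic_space sV Basis (\<lambda>x y. \<kappa> * B x y)"
proof (intro quadratic_space.intro quadratic_space_axioms.intro)
  assume \<kappa>: "\<kappa> \<noteq> 0"
  show "finite_dimensional_vector_space sV Basis" by (rule V.finite_dimensional_vector_space_axioms)
  show "bilinear_form sV (\<lambda>x y. \<kappa> * B x y)"
    by (auto simp: bilinear_form_def Vector_Spaces.linear_iff V.vector_space_axioms vector_space_field algebra_simps)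
  show "symmetric_form (\<lambda>x y. \<kappa> * B x y)" by (simp add: symmetric_form_def B_sym)
  show "nondegenerate_form (\<lambda>x y. \<kappa> * B x y)"
    using nondegenerate \<kappa> by (simp add: nondegenerate_form_def)
qed (rule two)

text \<open>The factor \<open>\<kappa>\<close> turns the anisotropic coefficient \<open>B r r\<close>, which need not be a square, into one.\<close>

lemma spin_model:
  assumes witt: "has_witt_index sV B p" and dim: "V.dim UNIV \<le> 2 * p + 1" and p: "p \<ge> 1"
    and ext: "exterior_power sV sW p wedge"
  obtains \<kappa> g U where "\<kappa> \<noteq> 0"
    "spin_rep sV Basis (\<lambda>x y. \<kappa> * B x y) g (proj_op (Pow {..<p})) U sW p wedge (Pow {..<p})"
    "V.dim UNIV = 2 * p \<Longrightarrow> \<kappa> = 1"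
    "\<And>v. V.dim UNIV = 2 * p \<Longrightarrow> grading p * g v = - (g v * grading p)"
proof -
  obtain U r and a b :: "nat \<Rightarrow> 'v" where U: "finite U" "\<And>u. u \<in> U \<Longrightarrow> B u u \<noteq> 0"
      "\<And>u w. u \<in> U \<Longrightarrow> w \<in> U \<Longrightarrow> u \<noteq> w \<Longrightarrow> B u w = 0" "V.span U = UNIV"
    and nf: "\<And>v. B v v = (\<Sum>i<p. 2 * B v (a i) * B v (b i)) + (B v r)\<^sup>2 / B r r"
    and r: "r \<noteq> 0 \<Longrightarrow> B r r \<noteq> 0" "V.dim UNIV = 2 * p \<Longrightarrow> r = 0"
    by (rule hyperbolic_normal_form[OF witt dim]) blast
  define \<kappa> where "\<kappa> = (if r = 0 then 1 else 1 / B r r)"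
  have \<kappa>: "\<kappa> \<noteq> 0" using r by (simp add: \<kappa>_def)
  \<comment> \<open>Only the products of creation and annihilation coefficients enter the square, so
    the whole factor \<open>2 * \<kappa>\<close> can sit on the creation side. For
    \<open>r = 0\<close> the parity coefficient is 0.\<close>
  define g where "g = fock_rep p (\<lambda>i v. 2 * \<kappa> * B v (a i)) (\<lambda>i v. B v (b i)) (\<lambda>v. B v r / B r r)"
  interpret S: quadratic_space sV Basis "\<lambda>x y. \<kappa> * B x y" by (rule rescaled[OF \<kappa>])
  have lin: "Vector_Spaces.linear sV (*) (\<lambda>v. c * B v x)" for c x
    by (auto simp: Vector_Spaces.linear_iff V.vector_space_axioms vector_space_field algebra_simps)
  have "clifford_rep sV Basis (\<lambda>x y. \<kappa> * B x y) scale_op g (proj_op (Pow {..<p}))"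
  proof (intro clifford_rep.intro clifford_rep_axioms.intro S.quadratic_space_axioms vector_space_scale_op)
    show "Vector_Spaces.linear sV scale_op g"
      unfolding g_def using lin[of 1] lin[of "1 / B r r" r] by (intro fock_rep_linear lin) auto
    show "g v * g v = scale_op (\<kappa> * B v v) (proj_op (Pow {..<p}))" for v
    proof -
      have "\<kappa> * ((B v r)\<^sup>2 / B r r) = (B v r / B r r)\<^sup>2"
        by (auto simp: \<kappa>_def power2_eq_square)
      then have "\<kappa> * B v v = (\<Sum>i<p. (2 * \<kappa> * B v (a i)) * B v (b i)) + (B v r / B r r)\<^sup>2"
        unfolding nf[of v] distrib_left sum_distrib_left by (simp add: mult_ac)
      then show ?thesis by (simp add: g_def fock_rep_square)
    qed
    show "proj_op (Pow {..<p}) \<noteq> (0 :: 'k op)"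
    proof
      assume "proj_op (Pow {..<p}) = (0 :: 'k op)"
      then have "app (proj_op (Pow {..<p})) (\<lambda>_. 1 :: 'k) {} = app 0 (\<lambda>_. 1) {}" by simp
      then show False by simp
    qed
    show "x = 0 \<or> z = 0" if "\<And>y. x * y * z = 0" for x z :: "'k op" using op_prime that by blast
  qed (simp_all add: scale_op_mult g_def)
  then interpret C: clifford_rep sV Basis "\<lambda>x y. \<kappa> * B x y" scale_op g "proj_op (Pow {..<p})" .
  have framed: "framed_clifford_rep sV Basis (\<lambda>x y. \<kappa> * B x y) scale_op g (proj_op (Pow {..<p})) U"
    using U \<kappa> by (intro framed_clifford_rep.intro framed_clifford_rep_axioms.intro C.clifford_rep_axioms) auto
  have "spin_rep sV Basis (\<lambda>x y. \<kappa> * B x y) g (proj_op (Pow {..<p})) U sW p wedge (Pow {..<p})"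
    using witt p ext has_witt_index_scale[OF \<kappa>]
    by (intro spin_rep.intro spin_rep_axioms.intro exterior_rep.intro exterior_rep_axioms.intro framed)
      (auto simp: card_Pow)
  moreover have "\<kappa> = 1" if "V.dim UNIV = 2 * p" using r(2)[OF that] by (simp add: \<kappa>_def)
  moreover have "grading p * g v = - (g v * grading p)" if "V.dim UNIV = 2 * p" for v
    using r(2)[OF that] grading_fock_rep unfolding g_def by simp
  ultimately show ?thesis using that \<kappa> by blast
qed

end

section \<open>Deduction of both statements from the spinor model\<close>

theorem corollary4p3:
  fixes sV :: "'k::field \<Rightarrow> 'v::ab_group_add \<Rightarrow> 'v"
    and sW :: "'k \<Rightarrow> 'w::ab_group_add \<Rightarrow> 'w"
    and B :: "'v \<Rightarrow> 'v \<Rightarrow> 'k"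
    and p :: nat
    and wedge :: "'v list \<Rightarrow> 'w"
  assumes "(2::'k) \<noteq> 0"
    and "p \<ge> 1"
    and "vector_space sV"
    and "bilinear_form sV B" and "symmetric_form B" and "nondegenerate_form B"
    and "p = vector_space.dim sV (UNIV :: 'v set) div 2"
    and "has_witt_index sV B p"
    and "exterior_power sV sW p wedge"
  shows "(vector_space.dim sV (UNIV :: 'v set) = 2 * p + 1 \<longrightarrow>
            (\<exists>Q. (\<forall>q\<in>Q. quadratic_form sW q \<and> quadric_rank q \<le> 4) \<and>
                 Gr_iso B p wedge = zero_locus Q)) \<and>
         (vector_space.dim sV (UNIV :: 'v set) = 2 * p \<longrightarrow>
            (\<forall>C\<in>Gr_iso_components sV B p wedge.
               \<exists>L Q. (\<forall>l\<in>L. Vector_Spaces.linear sW (*) l) \<and>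
                     (\<forall>q\<in>Q. quadratic_form sW q \<and> quadric_rank q \<le> 4) \<and>
                     C = zero_locus (L \<union> Q)))"
proof -
  interpret V: vector_space sV by fact
  obtain Basis where Basis: "V.independent Basis" "UNIV \<subseteq> V.span Basis" "card Basis = V.dim UNIV"
    using V.basis_exists[of UNIV] by metis
  \<comment> \<open>An infinite basis would have \<open>card\<close> equal to 0, so
    \<open>p \<ge> 1\<close> forces finite dimension.\<close>
  have "V.dim UNIV \<noteq> 0" using assms(2,7) by auto
  then have "finite Basis" using Basis(3) by (metis card.infinite)
  then interpret F: finite_dimensional_vector_space sV Basis
    using Basis by unfold_locales auto
  interpret quadratic_space sV Basis B
    using assms by unfold_locales auto
  have dim: "V.dim UNIV \<le> 2 * p + 1" using assms(7) by presburger
  obtain \<kappa> g U where \<kappa>: "\<kappa> \<noteq> 0" and spin: "spin_rep sV Basis (\<lambda>x y. \<kappa> * B x y) g (proj_op (Pow {..<p})) U sW p wedge (Pow {..<p})"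
    and even: "V.dim UNIV = 2 * p \<Longrightarrow> \<kappa> = 1" "\<And>v. V.dim UNIV = 2 * p \<Longrightarrow> grading p * g v = - (g v * grading p)"
    by (rule spin_model[OF assms(8) dim assms(2,9)]) blast
  interpret S: spin_rep sV Basis "\<lambda>x y. \<kappa> * B x y" g "proj_op (Pow {..<p})" U sW p wedge "Pow {..<p}"
    by (rule spin)
  have Gr: "Gr_iso B p wedge = zero_locus S.minors"
    using S.Gr_iso_eq_minors Gr_iso_rescale[OF \<kappa>] by metis
  show ?thesis
  proof (intro conjI impI ballI)
    show "\<exists>Q. (\<forall>q\<in>Q. quadratic_form sW q \<and> quadric_rank q \<le> 4) \<and> Gr_iso B p wedge = zero_locus Q"
      using Gr S.minors_quadrics by blast
  next
    fix C assume d: "V.dim UNIV = 2 * p" and C: "C \<in> Gr_iso_components sV B p wedge"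
    interpret G: graded_spin_rep sV Basis "\<lambda>x y. \<kappa> * B x y" g "proj_op (Pow {..<p})" U sW p wedge "Pow {..<p}" "grading p"
      by unfold_locales (simp_all add: grading_square even(2)[OF d])
    \<comment> \<open>In even dimension \<open>\<kappa> = 1\<close>, so the components for the
      rescaled form are those for \<open>B\<close> itself.\<close>
    obtain \<epsilon> where \<epsilon>: "C = {w \<in> Gr_iso B p wedge. grading p * S.rho w = scale_op \<epsilon> (S.rho w)}"
      using G.component_eq[of C] C even(1)[OF d] by auto
    obtain L where L: "\<forall>l\<in>L. Vector_Spaces.linear sW (*) l"
      "zero_locus L = {w. grading p * S.rho w = scale_op \<epsilon> (S.rho w)}"
      using G.component_linear_forms by blast
    have "zero_locus (L \<union> S.minors) = zero_locus L \<inter> zero_locus S.minors"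
      by (auto simp: zero_locus_def)
    then have "C = zero_locus (L \<union> S.minors)" using \<epsilon> L(2) Gr by auto
    then show "\<exists>L Q. (\<forall>l\<in>L. Vector_Spaces.linear sW (*) l) \<and>
        (\<forall>q\<in>Q. quadratic_form sW q \<and> quadric_rank q \<le> 4) \<and> C = zero_locus (L \<union> Q)"
      using L(1) S.minors_quadrics by blast
  qed
qed

end
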